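(* Let $n\geq 3$, let $\chi_1,\dots,\chi_n$ be characters of $\mathbb{F}_q^\times$, and put $\underline{\chi}_n=(\chi_1,\dots,\chi_n)$, $\underline{\chi}_{n-1}=(\chi_1,\dots,\chi_{n-1})$. Then for every $a_1\in\mathbb{F}_q^\times$, $$\Psi^{GL_n}_{\underline{\chi}_n}(g_{1,n-1}(a_1,1))=C'_n\sum_{t_1\in\mathbb{F}_q^\times}\chi_n\Big(-\frac{a_1}{t_1}\Big)\,\psi\Big(\frac{a_1}{t_1}\Big)\,\Psi^{GL_{n-1}}_{\underline{\chi}_{n-1}}(g_{1,n-2}(t_1,1)),$$ where $C'_n=\dfrac{q^{n-2}(q-1)}{q^n-1}$.
   Context: Let $\mathbb{F}_q$ be a finite field, $q$ a power of an odd prime, and $\psi:\mathbb{F}_q\to\mathbb{C}^\times$ a nontrivial additive character. For each $m\ge 2$ let $G_m=GL(m,\mathbb{F}_q)$, $U_m$ the subgroup of upper-triangular unipotent matrices, $B_m^-$ the subgroup of lower-triangular invertible matrices; extend $\psi$ to a character of $U_m$ by $\psi(u)=\psi(\sum_{i=1}^{m-1}u_{i,i+1})$. For $\underline{\chi}_m=(\chi_1,\dots,\chi_m)$, with $\chi_i$ characters of $\mathbb{F}_q^\times$, let $\underline{\chi}_m(b)=\prod_{i=1}^m\chi_i(b_{ii})$ for $b\in B_m^-$, and let $\mathcal{V}_{\underline{\chi}_m}=\{f:G_m\to\mathbb{C}\mid f(bg)=\underline{\chi}_m(b)f(g)\ \forall b\in B_m^-,g\in G_m\}$, on which $\pi_{\underline{\chi}_m}$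 acts by right translation, with inner product $\langle f_1,f_2\rangle=\frac{1}{|G_m|}\sum_{g\in G_m}f_1(g)\overline{f_2(g)}$. The Whittaker vector $\psi_m\in\mathcal{V}_{\underline{\chi}_m}$ is given by $\psi_m(bu)=\underline{\chi}_m(b)\psi(u)$ for $b\in B_m^-,u\in U_m$, and $\psi_m=0$ outside $B_m^-U_m$. The Whittaker function is $$\Psi^{GL_m}_{\underline{\chi}_m}(g)=\langle\pi_{\underline{\chi}_m}(g)\psi_m,\psi_m\rangle=\frac{1}{[G_m:B_m^-]}\sum_{u\in U_m}\psi_m(ug)\overline{\psi(u)},\qquad g\in G_m.$$ For $c_1,c_2\in\mathbb{F}_q^\times$, $g_{1,m-1}(c_1,c_2)\in G_m$ is the block anti-diagonal matrix $\begin{pmatrix}0&c_1\\ c_2I_{m-1}&0\end{pmatrix}$. *)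

theory Defs
  imports Complex_Main "HOL-Library.Cardinality" "Jordan_Normal_Form.Determinant"
begin

text \<open>
  The finite field is a type \<open>'a :: {field, finite}\<close> with \<open>q = CARD('a)\<close>. Matrices of varying size
  are \<open>'a mat\<close> with carrier \<open>carrier_mat m m\<close> and indices starting at 0.
  Functions on \<open>GL m\<close> are functions on \<open>'a mat\<close> of which only the values on \<open>GL m\<close> matter.
\<close>

definition additive_character :: "('a::{field,finite} \<Rightarrow> complex) \<Rightarrow> bool" where
  "additive_character \<psi> \<longleftrightarrow>
     (\<forall>x. \<psi> x \<noteq> 0) \<and> (\<forall>x y. \<psi> (x + y) = \<psi> x * \<psi> y)"

definition nontrivial_additive_character :: "('a::{field,finite} \<Rightarrow> complex) \<Rightarrow> bool" where
  "nontrivial_additive_character \<psi> \<longleftrightarrow> additive_character \<psi> \<and> (\<exists>x. \<psi> x \<noteq> 1)"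

(* A character of the multiplicative group; its value at 0 is irrelevant and unconstrained. *)
definition multiplicative_character :: "('a::{field,finite} \<Rightarrow> complex) \<Rightarrow> bool" where
  "multiplicative_character \<chi> \<longleftrightarrow>
     (\<forall>x. x \<noteq> 0 \<longrightarrow> \<chi> x \<noteq> 0) \<and>
     (\<forall>x y. x \<noteq> 0 \<longrightarrow> y \<noteq> 0 \<longrightarrow> \<chi> (x * y) = \<chi> x * \<chi> y)"

definition GL :: "nat \<Rightarrow> 'a::field mat set" where
  "GL m = {A \<in> carrier_mat m m. invertible_mat A}"

definition Unip :: "nat \<Rightarrow> 'a::field mat set" where
  "Unip m = {u \<in> GL m. upper_triangular u \<and> (\<forall>i<m. u $$ (i, i) = 1)}"

definition Borel_opp :: "nat \<Rightarrow> 'a::field mat set" where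
  "Borel_opp m = {b \<in> GL m. \<forall>i<m. \<forall>j<m. i < j \<longrightarrow> b $$ (i, j) = 0}"

definition unip_character :: "('a::field \<Rightarrow> complex) \<Rightarrow> nat \<Rightarrow> 'a mat \<Rightarrow> complex" where
  "unip_character \<psi> m u = \<psi> (\<Sum>i<m - 1. u $$ (i, Suc i))"

(* The tuple of characters is indexed by 1..m, as in chi_1, ..., chi_m, so chi_(i+1) is paired
   with the diagonal entry at (i, i). Truncating the tuple amounts to lowering m. *)
definition borel_character :: "(nat \<Rightarrow> 'a::field \<Rightarrow> complex) \<Rightarrow> nat \<Rightarrow> 'a mat \<Rightarrow> complex" where
  "borel_character \<chi> m b = (\<Prod>i<m. \<chi> (Suc i) (b $$ (i, i)))"

definition principal_series ::
  "(nat \<Rightarrow> 'a::field \<Rightarrow> complex) \<Rightarrow> nat \<Rightarrow> ('a mat \<Rightarrow> complex) set" where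
  "principal_series \<chi> m =
     {f. \<forall>b\<in>Borel_opp m. \<forall>g\<in>GL m. f (b * g) = borel_character \<chi> m b * f g}"

definition right_translation ::
  "'a::field mat \<Rightarrow> ('a mat \<Rightarrow> complex) \<Rightarrow> 'a mat \<Rightarrow> complex" where
  "right_translation g f = (\<lambda>h. f (h * g))"

definition GL_inner :: "nat \<Rightarrow> ('a::field mat \<Rightarrow> complex) \<Rightarrow> ('a mat \<Rightarrow> complex) \<Rightarrow> complex" where
  "GL_inner m f1 f2 =
     1 / of_nat (card (GL m :: 'a mat set)) * (\<Sum>g\<in>GL m. f1 g * cnj (f2 g))"

(* The description is well defined, see whittaker_vector_factor below. *)
definition whittaker_vector ::
  "('a::field \<Rightarrow> complex) \<Rightarrow> (nat \<Rightarrow> 'a \<Rightarrow> complex) \<Rightarrow> nat \<Rightarrow> 'a mat \<Rightarrow> complex" where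
  "whittaker_vector \<psi> \<chi> m g =
     (if \<exists>b\<in>Borel_opp m. \<exists>u\<in>Unip m. g = b * u
      then THE z. \<exists>b\<in>Borel_opp m. \<exists>u\<in>Unip m.
             g = b * u \<and> z = borel_character \<chi> m b * unip_character \<psi> m u
      else 0)"

definition whittaker_function ::
  "('a::field \<Rightarrow> complex) \<Rightarrow> (nat \<Rightarrow> 'a \<Rightarrow> complex) \<Rightarrow> nat \<Rightarrow> 'a mat \<Rightarrow> complex" where
  "whittaker_function \<psi> \<chi> m g =
     GL_inner m (right_translation g (whittaker_vector \<psi> \<chi> m)) (whittaker_vector \<psi> \<chi> m)"

definition antidiag_block :: "nat \<Rightarrow> 'a::field \<Rightarrow> 'a \<Rightarrow> 'a mat" where
  "antidiag_block m c1 c2 =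
     four_block_mat (0\<^sub>m 1 (m - 1)) (c1 \<cdot>\<^sub>m 1\<^sub>m 1)
                    (c2 \<cdot>\<^sub>m 1\<^sub>m (m - 1)) (0\<^sub>m (m - 1) 1)"

lemma antidiag_block_carrier: "m \<ge> 1 \<Longrightarrow> antidiag_block m c1 c2 \<in> carrier_mat m m"
  unfolding antidiag_block_def four_block_mat_def by (auto simp: Let_def)

lemma Borel_opp_carrier: "b \<in> Borel_opp m \<Longrightarrow> b \<in> carrier_mat m m"
  by (simp add: Borel_opp_def GL_def)

lemma Unip_carrier: "u \<in> Unip m \<Longrightarrow> u \<in> carrier_mat m m"
  by (simp add: Unip_def GL_def)

lemma GL_obtain_inverse:
  assumes "A \<in> GL m"
  obtains B where "B \<in> carrier_mat m m" "A * B = 1\<^sub>m m" "B * A = 1\<^sub>m m"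
proof -
  from assms have A: "A \<in> carrier_mat m m" and "invertible_mat A" by (auto simp: GL_def)
  then obtain B where AB: "A * B = 1\<^sub>m m" and BA: "B * A = 1\<^sub>m (dim_row B)"
    by (auto simp: invertible_mat_def inverts_mat_def)
  have "dim_col B = m" using arg_cong[OF AB, of dim_col] by simp
  moreover have "dim_row B = m" using arg_cong[OF BA, of dim_col] A by simp
  ultimately show ?thesis using that[of B] AB BA by auto
qed

lemma GL_iff_det: "A \<in> GL m \<longleftrightarrow> A \<in> carrier_mat m m \<and> det A \<noteq> 0"
proof
  assume A: "A \<in> GL m"
  obtain B where B: "B \<in> carrier_mat m m" "A * B = 1\<^sub>m m" using GL_obtain_inverse[OF A] .
  have "A \<in> carrier_mat m m" using A by (simp add: GL_def)
  moreover from det_mult[OF this B(1)] have "det A * det B = 1" using B by simp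
  ultimately show "A \<in> carrier_mat m m \<and> det A \<noteq> 0" by auto
next
  assume *: "A \<in> carrier_mat m m \<and> det A \<noteq> 0"
  then obtain B where "B \<in> carrier_mat m m" "A * B = 1\<^sub>m m" "B * A = 1\<^sub>m m"
    using det_non_zero_imp_unit[of A m] by (auto simp: Units_def ring_mat_simps)
  with * show "A \<in> GL m" by (auto simp: GL_def invertible_mat_def inverts_mat_def)
qed

lemma Borel_opp_diag_nonzero:
  assumes "b \<in> Borel_opp m" "i < m"
  shows "b $$ (i, i) \<noteq> 0"
proof -
  have b: "b \<in> carrier_mat m m" and d: "det b \<noteq> 0"
    using assms(1) GL_iff_det by (auto simp: Borel_opp_def)
  have "det b = prod_list (diag_mat b)"
    by (rule det_lower_triangular[of m]) (use assms b in \<open>auto simp: Borel_opp_def\<close>)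
  then have "(\<Prod>i = 0..<m. b $$ (i, i)) \<noteq> 0" using b d by (simp add: prod_list_diag_prod)
  then show ?thesis using assms(2) by auto
qed

lemma Borel_opp_Unip_entry:
  assumes b: "b \<in> Borel_opp m" and u: "u \<in> Unip m" and ij: "i < m" "j < m"
  shows "(b * u) $$ (i, j) = (\<Sum>k\<le>min i j. b $$ (i, k) * u $$ (k, j))"
proof -
  have "(b * u) $$ (i, j) = (\<Sum>k<m. b $$ (i, k) * u $$ (k, j))"
    using Borel_opp_carrier[OF b] Unip_carrier[OF u] ij
    by (simp add: scalar_prod_def atLeast0LessThan)
  also have "\<dots> = (\<Sum>k\<le>min i j. b $$ (i, k) * u $$ (k, j))"
  proof (rule sum.mono_neutral_right)
    show "\<forall>k\<in>{..<m} - {..min i j}. b $$ (i, k) * u $$ (k, j) = 0"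
      using b u ij Unip_carrier[OF u]
      by (auto simp: Borel_opp_def Unip_def upper_triangular_def min_def split: if_splits)
  qed (use ij in auto)
  finally show ?thesis .
qed

lemma Borel_opp_Unip_unique:
  assumes b: "b \<in> Borel_opp m" and u: "u \<in> Unip m"
    and b': "b' \<in> Borel_opp m" and u': "u' \<in> Unip m" and eq: "b * u = b' * u'"
  shows "b = b'" "u = u'"
proof -
  note [simp] = Borel_opp_carrier[OF b, THEN carrier_matD(1)] Borel_opp_carrier[OF b, THEN carrier_matD(2)]
    Borel_opp_carrier[OF b', THEN carrier_matD(1)] Borel_opp_carrier[OF b', THEN carrier_matD(2)]
    Unip_carrier[OF u, THEN carrier_matD(1)] Unip_carrier[OF u, THEN carrier_matD(2)]
    Unip_carrier[OF u', THEN carrier_matD(1)] Unip_carrier[OF u', THEN carrier_matD(2)]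
  have main: "(\<forall>i<m. k \<le> i \<longrightarrow> b $$ (i, k) = b' $$ (i, k)) \<and>
              (\<forall>j<m. k \<le> j \<longrightarrow> u $$ (k, j) = u' $$ (k, j))" if "k < m" for k
    using that
  proof (induction k rule: less_induct)
    case (less k)
    have split: "(\<Sum>l\<le>k. f l) = (\<Sum>l<k. f l) + f k" for f :: "nat \<Rightarrow> 'a"
      by (simp add: lessThan_Suc_atMost[symmetric])
    have low: "(\<Sum>l<k. b $$ (i, l) * u $$ (l, j)) = (\<Sum>l<k. b' $$ (i, l) * u' $$ (l, j))"
      if "i < m" "j < m" "k \<le> i" "k \<le> j" for i j
      by (rule sum.cong) (use less that in auto)
    have one: "u $$ (k, k) = 1" "u' $$ (k, k) = 1" using u u' less.prems by (auto simp: Unip_def)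
    have B: "b $$ (i, k) = b' $$ (i, k)" if i: "i < m" "k \<le> i" for i
    proof -
      have "(b * u) $$ (i, k) = (b' * u') $$ (i, k)" using eq by simp
      then show ?thesis
        using Borel_opp_Unip_entry[OF b u i(1) less.prems] Borel_opp_Unip_entry[OF b' u' i(1) less.prems]
          low[OF i(1) less.prems i(2)] one i by (simp add: split min_absorb2)
    qed
    have U: "u $$ (k, j) = u' $$ (k, j)" if j: "j < m" "k \<le> j" for j
    proof -
      have "(b * u) $$ (k, j) = (b' * u') $$ (k, j)" using eq by simp
      then have "b $$ (k, k) * u $$ (k, j) = b $$ (k, k) * u' $$ (k, j)"
        using Borel_opp_Unip_entry[OF b u less.prems j(1)] Borel_opp_Unip_entry[OF b' u' less.prems j(1)]
          low[OF less.prems j(1) _ j(2)] B[OF less.prems] j by (simp add: split min_absorb1)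
      then show ?thesis using Borel_opp_diag_nonzero[OF b less.prems] by simp
    qed
    show ?case using B U by blast
  qed
  show "b = b'"
  proof (rule eq_matI)
    fix i j assume "i < dim_row b'" "j < dim_col b'"
    then show "b $$ (i, j) = b' $$ (i, j)"
      using main[of j] b b' by (cases "j \<le> i") (auto simp: Borel_opp_def)
  qed simp_all
  show "u = u'"
  proof (rule eq_matI)
    fix i j assume "i < dim_row u'" "j < dim_col u'"
    then show "u $$ (i, j) = u' $$ (i, j)"
      using main[of i] u u' by (cases "i \<le> j") (auto simp: Unip_def upper_triangular_def)
  qed simp_all
qed

lemma whittaker_vector_factor:
  assumes "b \<in> Borel_opp m" "u \<in> Unip m"
  shows "whittaker_vector \<psi> \<chi> m (b * u) = borel_character \<chi> m b * unip_character \<psi> m u"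
proof -
  have "(THE z. \<exists>b'\<in>Borel_opp m. \<exists>u'\<in>Unip m. b * u = b' * u' \<and>
           z = borel_character \<chi> m b' * unip_character \<psi> m u') =
        borel_character \<chi> m b * unip_character \<psi> m u"
    by (rule the_equality) (use assms Borel_opp_Unip_unique[OF assms] in blast)+
  then show ?thesis using assms unfolding whittaker_vector_def by auto
qed

lemma whittaker_vector_outside:
  "(\<And>b u. b \<in> Borel_opp m \<Longrightarrow> u \<in> Unip m \<Longrightarrow> g \<noteq> b * u) \<Longrightarrow> whittaker_vector \<psi> \<chi> m g = 0"
  unfolding whittaker_vector_def by auto

lemma Borel_opp_mult:
  assumes b: "b \<in> Borel_opp m" and c: "c \<in> Borel_opp m"
  shows "b * c \<in> Borel_opp m"
    and "\<And>i. i < m \<Longrightarrow> (b * c) $$ (i, i) = b $$ (i, i) * c $$ (i, i)"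
proof -
  note bc = Borel_opp_carrier[OF b] Borel_opp_carrier[OF c]
  have entry: "(b * c) $$ (i, j) = (\<Sum>k<m. b $$ (i, k) * c $$ (k, j))" if "i < m" "j < m" for i j
    using bc that by (simp add: scalar_prod_def atLeast0LessThan)
  have "det (b * c) \<noteq> 0"
    using b c bc by (simp add: det_mult Borel_opp_def GL_iff_det)
  then have "b * c \<in> GL m" using bc by (simp add: GL_iff_det)
  moreover have "(b * c) $$ (i, j) = 0" if "i < m" "j < m" "i < j" for i j
    unfolding entry[OF that(1,2)]
  proof (rule sum.neutral, intro ballI)
    fix k assume "k \<in> {..<m}"
    then show "b $$ (i, k) * c $$ (k, j) = 0"
      using that b c by (cases "i < k") (auto simp: Borel_opp_def)
  qed
  ultimately show "b * c \<in> Borel_opp m" by (simp add: Borel_opp_def)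
  fix i assume i: "i < m"
  have "(\<Sum>k<m. b $$ (i, k) * c $$ (k, i)) = (\<Sum>k\<in>{i}. b $$ (i, k) * c $$ (k, i))"
  proof (rule sum.mono_neutral_right)
    show "\<forall>k\<in>{..<m} - {i}. b $$ (i, k) * c $$ (k, i) = 0"
    proof
      fix k assume "k \<in> {..<m} - {i}"
      then show "b $$ (i, k) * c $$ (k, i) = 0"
        using i b c by (cases "i < k") (auto simp: Borel_opp_def)
    qed
  qed (use i in auto)
  then show "(b * c) $$ (i, i) = b $$ (i, i) * c $$ (i, i)" using entry[OF i i] by simp
qed

lemma finite_carrier_mat: "finite (carrier_mat m n :: 'a::finite mat set)"
proof (rule finite_subset)
  let ?F = "PiE ({..<m} \<times> {..<n}) (\<lambda>_. UNIV :: 'a set)"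
  show "finite ((\<lambda>f. mat m n f) ` ?F)" by (intro finite_imageI finite_PiE) auto
  show "carrier_mat m n \<subseteq> (\<lambda>f. mat m n f) ` ?F"
  proof
    fix A :: "'a mat" assume A: "A \<in> carrier_mat m n"
    let ?f = "restrict (\<lambda>ij. A $$ ij) ({..<m} \<times> {..<n})"
    have "A = mat m n ?f" by (rule eq_matI) (use A in auto)
    moreover have "?f \<in> ?F" by (rule restrict_PiE[THEN iffD2]) simp
    ultimately show "A \<in> (\<lambda>f. mat m n f) ` ?F" by (rule image_eqI)
  qed
qed

lemma Borel_opp_left_inverse:
  fixes b :: "'a::{field,finite} mat"
  assumes b: "b \<in> Borel_opp m"
  obtains c where "c \<in> Borel_opp m" "c * b = 1\<^sub>m m"
proof -
  have fin: "finite (Borel_opp m :: 'a mat set)"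
    by (rule finite_subset[OF _ finite_carrier_mat[of m m]]) (auto simp: Borel_opp_carrier)
  have "b \<in> GL m" using b by (simp add: Borel_opp_def)
  then obtain d where d: "d \<in> carrier_mat m m" "b * d = 1\<^sub>m m" by (rule GL_obtain_inverse)
  have "inj_on (\<lambda>c. c * b) (Borel_opp m)"
  proof (rule inj_onI)
    fix x y assume xy: "x \<in> Borel_opp m" "y \<in> Borel_opp m" "x * b = y * b"
    then have "(x * b) * d = (y * b) * d" by simp
    then show "x = y"
      using xy(1,2)[THEN Borel_opp_carrier] Borel_opp_carrier[OF b] d
      by (simp add: assoc_mult_mat[of _ m m _ m _ m])
  qed
  moreover have "(\<lambda>c. c * b) ` Borel_opp m \<subseteq> Borel_opp m" using Borel_opp_mult(1) b by blast
  ultimately have "(\<lambda>c. c * b) ` Borel_opp m = Borel_opp m" using endo_inj_surj fin by blast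
  moreover have "1\<^sub>m m \<in> Borel_opp m" by (auto simp: Borel_opp_def GL_iff_det)
  ultimately have "1\<^sub>m m \<in> (\<lambda>c. c * b) ` Borel_opp m" by simp
  then obtain c where "c \<in> Borel_opp m" "1\<^sub>m m = c * b" by (rule imageE)
  then show ?thesis using that[of c] by simp
qed

lemma whittaker_vector_in_principal_series:
  fixes \<chi> :: "nat \<Rightarrow> 'a::{field,finite} \<Rightarrow> complex"
  assumes \<chi>: "\<And>i. i \<in> {1..m} \<Longrightarrow> multiplicative_character (\<chi> i)"
  shows "whittaker_vector \<psi> \<chi> m \<in> principal_series \<chi> m"
  unfolding principal_series_def
proof (intro CollectI ballI)
  fix b g :: "'a mat" assume b: "b \<in> Borel_opp m" and g: "g \<in> GL m"
  note bC = Borel_opp_carrier[OF b]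
  show "whittaker_vector \<psi> \<chi> m (b * g) = borel_character \<chi> m b * whittaker_vector \<psi> \<chi> m g"
  proof (cases "\<exists>b'\<in>Borel_opp m. \<exists>u\<in>Unip m. g = b' * u")
    case True
    then obtain b' u where b': "b' \<in> Borel_opp m" and u: "u \<in> Unip m" and eq: "g = b' * u" by blast
    have "b * g = (b * b') * u"
      unfolding eq using bC Borel_opp_carrier[OF b'] Unip_carrier[OF u] by simp
    moreover have "borel_character \<chi> m (b * b') = borel_character \<chi> m b * borel_character \<chi> m b'"
      unfolding borel_character_def prod.distrib[symmetric]
    proof (rule prod.cong)
      fix i assume "i \<in> {..<m}"
      then show "\<chi> (Suc i) ((b * b') $$ (i, i)) = \<chi> (Suc i) (b $$ (i, i)) * \<chi> (Suc i) (b' $$ (i, i))"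
        using \<chi>[of "Suc i"] Borel_opp_diag_nonzero[OF b, of i] Borel_opp_diag_nonzero[OF b', of i]
          Borel_opp_mult(2)[OF b b', of i]
        by (auto simp: multiplicative_character_def)
    qed simp
    ultimately show ?thesis
      using whittaker_vector_factor[OF Borel_opp_mult(1)[OF b b'] u]
        whittaker_vector_factor[OF b' u] eq by simp
  next
    case False
    obtain c where c: "c \<in> Borel_opp m" "c * b = 1\<^sub>m m" using Borel_opp_left_inverse[OF b] .
    have gC: "g \<in> carrier_mat m m" using g by (simp add: GL_def)
    have "b * g \<noteq> b' * u" if b': "b' \<in> Borel_opp m" and u: "u \<in> Unip m" for b' u
    proof
      assume "b * g = b' * u"
      then have "c * (b * g) = c * (b' * u)" by simp
      moreover have "c * (b * g) = (c * b) * g"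
        using assoc_mult_mat[OF Borel_opp_carrier[OF c(1)] bC gC] by simp
      moreover have "c * (b' * u) = (c * b') * u"
        using assoc_mult_mat[OF Borel_opp_carrier[OF c(1)] Borel_opp_carrier[OF b'] Unip_carrier[OF u]]
        by simp
      ultimately have "g = (c * b') * u" using c(2) gC by simp
      then show False using False Borel_opp_mult(1)[OF c(1) b'] u by blast
    qed
    then have "whittaker_vector \<psi> \<chi> m (b * g) = 0" by (intro whittaker_vector_outside) auto
    moreover have "whittaker_vector \<psi> \<chi> m g = 0"
      using False by (intro whittaker_vector_outside) blast
    ultimately show ?thesis by simp
  qed
qed

end

theory Submission
  imports Defs "Jordan_Normal_Form.Gauss_Jordan_Elimination"
begin

text \<open>
  Write an element of \<open>U\<^sub>n\<close>, \<open>n = m + 1\<close>, as \<open>u\<close> in \<open>U\<^sub>m\<close> bordered by a last column \<open>u c\<close>. The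
  leading \<open>m \<times> m\<close> block of its product with \<open>g\<^sub>1\<^sub>,\<^sub>m(a,1)\<close> is \<open>M = u g\<^sub>1\<^sub>,\<^sub>m\<^sub>-\<^sub>1(t,1) N\<close>, where \<open>t\<close>
  is the first entry of \<open>c\<close> and \<open>N\<close> is the unipotent matrix whose last column consists of the other
  entries of \<open>c\<close>. Hence the product can lie in \<open>B\<^sup>-U\<close> only if \<open>t \<noteq> 0\<close> and \<open>M\<close> lies in \<open>B\<^sup>-U\<close>; in that
  case its last diagonal entry is \<open>-a/t\<close> and its last superdiagonal entry is \<open>a/t\<close>. The factor
  contributed by \<open>N\<close> cancels against the last superdiagonal entry of the element of \<open>U\<^sub>n\<close>, so the
  remaining \<open>m - 1\<close> entries of \<open>c\<close> contribute \<open>q\<^sup>m\<^sup>-\<^sup>1\<close>. The rest of the constant is the ratio of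
  the indices \<open>[G\<^sub>m : B\<^sub>m\<^sup>-]\<close> and \<open>[G\<^sub>n : B\<^sub>n\<^sup>-]\<close>.
\<close>

section \<open>The Whittaker function as a sum over unipotent matrices\<close>

text \<open>Translation by \<open>x\<close> permutes the field, so the product of all values of
  \<psi> equals itself times \<open>\<psi> x ^ CARD('a)\<close>. Hence \<open>\<psi> x\<close> is a
  root of unity, although the definition asks only for nonzero values.\<close>

lemma additive_character_unimodular:
  assumes "additive_character \<psi>"
  shows "\<psi> x * cnj (\<psi> x) = 1"
proof -
  have ne: "(\<Prod>y\<in>UNIV. \<psi> y) \<noteq> 0"
    using assms by (simp add: additive_character_def)
  have "(\<Prod>y\<in>UNIV. \<psi> y) = (\<Prod>y\<in>UNIV. \<psi> (x + y))"
    by (rule prod.reindex_bij_witness[of _ "\<lambda>y. x + y" "\<lambda>y. y - x"]) auto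
  also have "\<dots> = \<psi> x ^ CARD('a) * (\<Prod>y\<in>UNIV. \<psi> y)"
    using assms by (simp add: additive_character_def prod.distrib)
  finally have "\<psi> x ^ CARD('a) = 1" using ne by simp
  then have "norm (\<psi> x) ^ CARD('a) = 1 ^ CARD('a)" by (simp add: norm_power[symmetric])
  then have "norm (\<psi> x) = 1" by (rule power_eq_imp_eq_base) simp_all
  then show ?thesis by (simp add: complex_norm_square[symmetric])
qed

text \<open>Same argument with multiplication by \<open>x\<close>, which permutes the nonzero
  elements; 0 is left out because \<open>\<chi> 0\<close> is unconstrained.\<close>

lemma multiplicative_character_unimodular:
  fixes \<chi> :: "'a::{field,finite} \<Rightarrow> complex"
  assumes "multiplicative_character \<chi>" "x \<noteq> 0"
  shows "\<chi> x * cnj (\<chi> x) = 1"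
proof -
  let ?S = "UNIV - {0 :: 'a}"
  have ne: "(\<Prod>y\<in>?S. \<chi> y) \<noteq> 0"
    using assms by (auto simp: multiplicative_character_def)
  have "(\<Prod>y\<in>?S. \<chi> y) = (\<Prod>y\<in>?S. \<chi> (x * y))"
    by (rule prod.reindex_bij_witness[of _ "\<lambda>y. x * y" "\<lambda>y. y / x"]) (use assms in auto)
  also have "\<dots> = (\<Prod>y\<in>?S. \<chi> x * \<chi> y)"
    by (rule prod.cong) (use assms in \<open>auto simp: multiplicative_character_def\<close>)
  also have "\<dots> = \<chi> x ^ card ?S * (\<Prod>y\<in>?S. \<chi> y)"
    by (simp add: prod.distrib)
  finally have "\<chi> x ^ card ?S = 1" using ne by (simp del: card_Diff_insert)
  then have "norm (\<chi> x) ^ card ?S = 1 ^ card ?S"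
    unfolding norm_power[symmetric] power_one by (simp del: card_Diff_insert)
  moreover have "card ?S > 0"
    using assms(2) by (intro iffD2[OF card_gt_0_iff]) auto
  ultimately have "norm (\<chi> x) = 1"
    by (intro power_eq_imp_eq_base[of "norm (\<chi> x)" "card ?S" 1]) simp_all
  then show ?thesis by (simp add: complex_norm_square[symmetric])
qed

lemma Unip_iff:
  "u \<in> Unip m \<longleftrightarrow> u \<in> carrier_mat m m \<and> upper_triangular u \<and> (\<forall>i<m. u $$ (i, i) = 1)"
proof -
  have "det u \<noteq> 0" if "u \<in> carrier_mat m m" "upper_triangular u" "\<forall>i<m. u $$ (i, i) = 1"
    using that det_upper_triangular[of u m] by (simp add: prod_list_diag_prod)
  then show ?thesis unfolding Unip_def GL_iff_det by blast
qed

lemma Borel_opp_iff: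
  "b \<in> Borel_opp m \<longleftrightarrow> b \<in> carrier_mat m m \<and> (\<forall>i<m. \<forall>j<m. i < j \<longrightarrow> b $$ (i, j) = 0) \<and>
     (\<forall>i<m. b $$ (i, i) \<noteq> 0)"
proof
  assume "b \<in> Borel_opp m"
  then show "b \<in> carrier_mat m m \<and> (\<forall>i<m. \<forall>j<m. i < j \<longrightarrow> b $$ (i, j) = 0) \<and>
     (\<forall>i<m. b $$ (i, i) \<noteq> 0)"
    using Borel_opp_diag_nonzero[of b m] by (auto simp: Borel_opp_def GL_def)
next
  assume *: "b \<in> carrier_mat m m \<and> (\<forall>i<m. \<forall>j<m. i < j \<longrightarrow> b $$ (i, j) = 0) \<and>
     (\<forall>i<m. b $$ (i, i) \<noteq> 0)"
  then have "det b = prod_list (diag_mat b)"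
    by (intro det_lower_triangular[of m]) auto
  with * show "b \<in> Borel_opp m" by (auto simp: Borel_opp_def GL_iff_det prod_list_diag_prod)
qed

lemma GL_mult: "A \<in> GL m \<Longrightarrow> B \<in> GL m \<Longrightarrow> A * B \<in> GL m"
  by (auto simp: GL_iff_det det_mult)

lemma Borel_opp_subset_GL: "Borel_opp m \<subseteq> GL m"
  by (auto simp: Borel_opp_def)

lemma Unip_subset_GL: "Unip m \<subseteq> GL m"
  by (auto simp: Unip_def)

lemma finite_GL [simp]: "finite (GL m :: 'a::{field,finite} mat set)"
  by (rule finite_subset[OF _ finite_carrier_mat[of m m]]) (auto simp: GL_def)

lemma borel_character_unimodular:
  fixes \<chi> :: "nat \<Rightarrow> 'a::{field,finite} \<Rightarrow> complex"
  assumes "\<And>i. i \<in> {1..m} \<Longrightarrow> multiplicative_character (\<chi> i)" "b \<in> Borel_opp m"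
  shows "borel_character \<chi> m b * cnj (borel_character \<chi> m b) = 1"
  unfolding borel_character_def cnj_prod prod.distrib[symmetric]
  by (rule prod.neutral)
    (use assms Borel_opp_diag_nonzero in \<open>auto intro!: multiplicative_character_unimodular\<close>)

text \<open>The sum over the unipotent group in the second formula for the Whittaker function,
  without the index of the Borel subgroup. The recursion is proved for this sum, and the indices are
  compared separately.\<close>

definition whittaker_sum ::
  "('a::field \<Rightarrow> complex) \<Rightarrow> (nat \<Rightarrow> 'a \<Rightarrow> complex) \<Rightarrow> nat \<Rightarrow> 'a mat \<Rightarrow> complex" where
  "whittaker_sum \<psi> \<chi> m g =
     (\<Sum>u\<in>Unip m. whittaker_vector \<psi> \<chi> m (u * g) * cnj (unip_character \<psi> m u))"

text \<open>The Whittaker vector is supported on the open cell, where \<open>b * u\<close>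
  determines \<open>b\<close> and \<open>u\<close>. There the summand is independent of
  \<open>b\<close>, so the sum over \<open>b\<close> contributes only the order of the Borel
  subgroup.\<close>

lemma whittaker_function_eq_sum:
  fixes \<chi> :: "nat \<Rightarrow> 'a::{field,finite} \<Rightarrow> complex"
  assumes \<chi>: "\<And>i. i \<in> {1..m} \<Longrightarrow> multiplicative_character (\<chi> i)" and g: "g \<in> GL m"
  shows "whittaker_function \<psi> \<chi> m g =
    of_nat (card (Borel_opp m :: 'a mat set)) / of_nat (card (GL m :: 'a mat set)) *
    whittaker_sum \<psi> \<chi> m g"
proof -
  let ?w = "whittaker_vector \<psi> \<chi> m"
  let ?X = "Borel_opp m \<times> Unip m :: ('a mat \<times> 'a mat) set"
  let ?F = "\<lambda>h. ?w (h * g) * cnj (?w h)"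
  have inj: "inj_on (\<lambda>(b, u). b * u) ?X"
    by (rule inj_onI) (auto dest: Borel_opp_Unip_unique)
  have "(\<Sum>h\<in>GL m. ?F h) = (\<Sum>h\<in>(\<lambda>(b, u). b * u) ` ?X. ?F h)"
  proof (rule sum.mono_neutral_right)
    show "(\<lambda>(b, u). b * u) ` ?X \<subseteq> GL m"
      using Borel_opp_subset_GL Unip_subset_GL by (auto intro!: GL_mult)
    show "\<forall>h\<in>GL m - (\<lambda>(b, u). b * u) ` ?X. ?F h = 0"
    proof
      fix h assume "h \<in> GL m - (\<lambda>(b, u). b * u) ` ?X"
      then have "?w h = 0" by (intro whittaker_vector_outside) auto
      then show "?F h = 0" by simp
    qed
  qed simp
  also have "\<dots> = (\<Sum>(b, u)\<in>?X. ?F (b * u))"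
    by (subst sum.reindex[OF inj]) (simp add: case_prod_unfold)
  \<comment> \<open>Equivariance takes \<open>borel_character \<chi> m b\<close> out of one value of
    the vector and its conjugate out of the other; these two factors multiply to 1.\<close>
  also have "\<dots> = (\<Sum>(b, u)\<in>?X. ?w (u * g) * cnj (unip_character \<psi> m u))"
  proof (rule sum.cong[OF refl], clarify)
    fix b u :: "'a mat" assume b: "b \<in> Borel_opp m" and u: "u \<in> Unip m"
    have gC: "g \<in> carrier_mat m m" using g by (simp add: GL_def)
    have ug: "u * g \<in> GL m" using u g Unip_subset_GL by (auto intro!: GL_mult)
    have "b * u * g = b * (u * g)"
      using Borel_opp_carrier[OF b] Unip_carrier[OF u] gC by simp
    then have "?w (b * u * g) = borel_character \<chi> m b * ?w (u * g)"
      using whittaker_vector_in_principal_series[of m \<chi> \<psi>] \<chi> b ug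
      by (simp add: principal_series_def)
    then show "?F (b * u) = ?w (u * g) * cnj (unip_character \<psi> m u)"
      using borel_character_unimodular[of m \<chi> b] \<chi> b
      by (simp add: whittaker_vector_factor[OF b u] mult_ac)
  qed
  also have "\<dots> = of_nat (card (Borel_opp m :: 'a mat set)) * whittaker_sum \<psi> \<chi> m g"
    by (simp add: sum.cartesian_product[symmetric] whittaker_sum_def)
  finally show ?thesis
    by (simp add: whittaker_function_def GL_inner_def right_translation_def)
qed

section \<open>Orders of the groups\<close>

lemma card_carrier_mat:
  "card (carrier_mat m n :: 'a::finite mat set) = CARD('a) ^ (m * n)"
proof -
  let ?I = "{..<m} \<times> {..<n}"
  have "bij_betw (\<lambda>f. mat m n f) (PiE ?I (\<lambda>_. UNIV :: 'a set)) (carrier_mat m n)"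
  proof (rule bij_betw_byWitness[where f' = "\<lambda>A. restrict (($$) A) ?I"])
    show "\<forall>f\<in>PiE ?I (\<lambda>_. UNIV :: 'a set). restrict (($$) (mat m n f)) ?I = f"
      by (auto simp: fun_eq_iff PiE_def extensional_def restrict_def)
  qed (auto simp: PiE_def)
  then have "card (carrier_mat m n :: 'a mat set) = card (PiE ?I (\<lambda>_. UNIV :: 'a set))"
    by (rule bij_betw_same_card[symmetric])
  also have "\<dots> = CARD('a) ^ (m * n)"
    by (simp add: card_PiE card_cartesian_product)
  finally show ?thesis .
qed

section \<open>Block decompositions and the order of the Borel subgroup\<close>

lemma four_block_mat_inject:
  assumes "A \<in> carrier_mat nr1 nc1" "A' \<in> carrier_mat nr1 nc1"
    and "B \<in> carrier_mat nr1 nc2" "B' \<in> carrier_mat nr1 nc2"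
    and "C \<in> carrier_mat nr2 nc1" "C' \<in> carrier_mat nr2 nc1"
    and "D \<in> carrier_mat nr2 nc2" "D' \<in> carrier_mat nr2 nc2"
    and eq: "four_block_mat A B C D = four_block_mat A' B' C' D'"
  shows "A = A'" "B = B'" "C = C'" "D = D'"
proof -
  have e: "four_block_mat A B C D $$ (i, j) = four_block_mat A' B' C' D' $$ (i, j)" for i j
    using eq by simp
  show "A = A'"
  proof (rule eq_matI)
    fix i j assume "i < dim_row A'" "j < dim_col A'"
    then show "A $$ (i, j) = A' $$ (i, j)" using e[of i j] assms(1-8) by auto
  qed (use assms(1-8) in auto)
  show "B = B'"
  proof (rule eq_matI)
    fix i j assume "i < dim_row B'" "j < dim_col B'"
    then show "B $$ (i, j) = B' $$ (i, j)" using e[of i "j + nc1"] assms(1-8) by auto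
  qed (use assms(1-8) in auto)
  show "C = C'"
  proof (rule eq_matI)
    fix i j assume "i < dim_row C'" "j < dim_col C'"
    then show "C $$ (i, j) = C' $$ (i, j)" using e[of "i + nr1" j] assms(1-8) by auto
  qed (use assms(1-8) in auto)
  show "D = D'"
  proof (rule eq_matI)
    fix i j assume "i < dim_row D'" "j < dim_col D'"
    then show "D $$ (i, j) = D' $$ (i, j)" using e[of "i + nr1" "j + nc1"] assms(1-8) by auto
  qed (use assms(1-8) in auto)
qed

lemma four_block_mat_cases:
  assumes "A \<in> carrier_mat (nr1 + nr2) (nc1 + nc2)"
  obtains A1 A2 A3 A4 where "A1 \<in> carrier_mat nr1 nc1" "A2 \<in> carrier_mat nr1 nc2"
    "A3 \<in> carrier_mat nr2 nc1" "A4 \<in> carrier_mat nr2 nc2"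
    "A = four_block_mat A1 A2 A3 A4"
proof -
  obtain A1 A2 A3 A4 where "split_block A nr1 nc1 = (A1, A2, A3, A4)"
    by (cases "split_block A nr1 nc1") auto
  from split_block[OF this, of nr2 nc2] assms show ?thesis using that by auto
qed

lemma mat_1_1_eq: "(D :: 'a::field mat) \<in> carrier_mat 1 1 \<Longrightarrow> D = D $$ (0, 0) \<cdot>\<^sub>m 1\<^sub>m 1"
  by (rule eq_matI) auto

text \<open>The last column of a lower triangular matrix is zero above its corner, so only the
  leading block, the last row and a nonzero corner are free. This serves both the count of the group
  and the factorisation of bordered matrices.\<close>

lemma Borel_opp_Suc:
  "bij_betw (\<lambda>(b, r, d). four_block_mat b (0\<^sub>m m 1) r (d \<cdot>\<^sub>m 1\<^sub>m 1))
    (Borel_opp m \<times> carrier_mat 1 m \<times> (UNIV - {0})) (Borel_opp (Suc m) :: 'a::field mat set)"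
  (is "bij_betw ?f ?X _")
proof (rule bij_betw_imageI)
  show "inj_on ?f ?X"
  proof (rule inj_onI)
    fix x x' assume x: "x \<in> ?X" "x' \<in> ?X" and xx': "?f x = ?f x'"
    obtain b r d b' r' d' where x_eq: "x = (b, r, d)" "x' = (b', r', d')"
      by (cases x, cases x')
    have b: "b \<in> Borel_opp m" "b' \<in> Borel_opp m"
      and r: "r \<in> carrier_mat 1 m" "r' \<in> carrier_mat 1 m"
      and eq: "four_block_mat b (0\<^sub>m m 1) r (d \<cdot>\<^sub>m 1\<^sub>m 1) =
        four_block_mat b' (0\<^sub>m m 1) r' (d' \<cdot>\<^sub>m 1\<^sub>m 1)"
      using x xx' unfolding x_eq by simp_all
    have d: "d \<cdot>\<^sub>m 1\<^sub>m 1 \<in> carrier_mat 1 1" "d' \<cdot>\<^sub>m 1\<^sub>m 1 \<in> carrier_mat 1 1" by simp_all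
    note inj = four_block_mat_inject[OF b[THEN Borel_opp_carrier] zero_carrier_mat zero_carrier_mat r d eq]
    have "(d \<cdot>\<^sub>m 1\<^sub>m 1) $$ (0, 0) = (d' \<cdot>\<^sub>m 1\<^sub>m 1) $$ (0, 0)"
      by (subst inj(4)) simp_all
    then show "x = x'" using inj(1,3) by (simp add: x_eq)
  qed
  show "?f ` ?X = Borel_opp (Suc m)"
  proof (intro equalityI subsetI)
    fix A assume "A \<in> ?f ` ?X"
    then obtain b r d where "b \<in> Borel_opp m" "r \<in> carrier_mat 1 m" "d \<noteq> 0"
      and A: "A = four_block_mat b (0\<^sub>m m 1) r (d \<cdot>\<^sub>m 1\<^sub>m 1)" by auto
    then show "A \<in> Borel_opp (Suc m)"
      by (auto simp: Borel_opp_iff less_Suc_eq)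
  next
    fix A :: "'a mat" assume A: "A \<in> Borel_opp (Suc m)"
    obtain b s r d where blocks: "b \<in> carrier_mat m m" "s \<in> carrier_mat m 1"
      "r \<in> carrier_mat 1 m" "d \<in> carrier_mat 1 1" "A = four_block_mat b s r d"
      by (rule four_block_mat_cases[of A m 1 m 1]) (use Borel_opp_carrier[OF A] in auto)
    have e: "A $$ (i, j) = four_block_mat b s r d $$ (i, j)" for i j using blocks by simp
    have "s = 0\<^sub>m m 1"
    proof (rule eq_matI)
      fix i j assume "i < dim_row (0\<^sub>m m 1 :: 'a mat)" "j < dim_col (0\<^sub>m m 1 :: 'a mat)"
      then have i: "i < m" "j = 0" by auto
      then have "A $$ (i, m) = 0" using A by (simp add: Borel_opp_iff)
      then show "s $$ (i, j) = 0\<^sub>m m 1 $$ (i, j)"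
        using e[of i m] blocks(1-4) i by auto
    qed (use blocks in auto)
    moreover have "d $$ (0, 0) \<noteq> 0"
      using Borel_opp_diag_nonzero[OF A, of m] e[of m m] blocks(1-4) by simp
    moreover have "b \<in> Borel_opp m"
      unfolding Borel_opp_iff
    proof (intro conjI allI impI)
      fix i j assume "i < m" "j < m" "i < j"
      moreover from this have "A $$ (i, j) = 0" using A by (simp add: Borel_opp_iff)
      ultimately show "b $$ (i, j) = 0" using e[of i j] blocks(1-4) by simp
    next
      fix i assume "i < m"
      then show "b $$ (i, i) \<noteq> 0"
        using Borel_opp_diag_nonzero[OF A, of i] e[of i i] blocks(1-4) by simp
    qed (use blocks in auto)
    ultimately show "A \<in> ?f ` ?X"
      using blocks mat_1_1_eq[OF blocks(4)]
      by (intro image_eqI[of _ _ "(b, r, d $$ (0, 0))"]) auto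
  qed
qed

lemma card_Borel_opp_Suc:
  "card (Borel_opp (Suc m) :: 'a::{field,finite} mat set) =
    card (Borel_opp m :: 'a mat set) * CARD('a) ^ m * (CARD('a) - 1)"
  using bij_betw_same_card[OF Borel_opp_Suc[where 'a = 'a and m = m]]
  by (simp add: card_cartesian_product card_carrier_mat card_Diff_subset)

section \<open>The general linear group acting on nonzero columns\<close>

lemma GL_mult_cancel_left:
  assumes "P \<in> GL m" "A \<in> carrier_mat m n" "B \<in> carrier_mat m n" "P * A = P * B"
  shows "A = B"
proof -
  have P: "P \<in> carrier_mat m m" using assms(1) by (simp add: GL_def)
  obtain Q where Q: "Q \<in> carrier_mat m m" "Q * P = 1\<^sub>m m" using GL_obtain_inverse[OF assms(1)] .
  have "Q * P * A = Q * P * B"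
    using assms P Q(1) by simp
  then show ?thesis using Q assms by simp
qed

text \<open>The first standard basis vector, kept as a one-column matrix so that it can be
  multiplied with \<open>*\<close> and used as a block.\<close>

definition unit_col :: "nat \<Rightarrow> 'a::zero_neq_one mat" where
  "unit_col m = mat m 1 (\<lambda>(i, j). if i = 0 then 1 else 0)"

lemma unit_col_carrier [simp]: "unit_col m \<in> carrier_mat m 1"
  by (simp add: unit_col_def)

lemma mult_unit_col_entry:
  fixes A :: "'a::field mat"
  assumes "A \<in> carrier_mat n (Suc m)" "i < n"
  shows "(A * unit_col (Suc m)) $$ (i, 0) = A $$ (i, 0)"
proof -
  have "(A * unit_col (Suc m)) $$ (i, 0) = (\<Sum>k\<in>{0..<Suc m}. A $$ (i, k) * (if k = 0 then 1 else 0))"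
    using assms by (simp add: scalar_prod_def unit_col_def)
  also have "\<dots> = A $$ (i, 0)" by (simp add: if_distrib sum.delta cong: if_cong)
  finally show ?thesis .
qed

text \<open>A row swap brings a nonzero entry of \<open>v\<close> to the top, and a column with
  nonzero top entry is the first column of an invertible lower triangular matrix.\<close>

lemma GL_transitive:
  fixes v :: "'a::field mat"
  assumes v: "v \<in> carrier_mat (Suc m) 1" "v \<noteq> 0\<^sub>m (Suc m) 1"
  obtains P where "P \<in> GL (Suc m)" "P * unit_col (Suc m) = v"
proof -
  have "\<exists>i<Suc m. v $$ (i, 0) \<noteq> 0"
  proof (rule ccontr)
    assume "\<not> ?thesis"
    then have "v = 0\<^sub>m (Suc m) 1" by (intro eq_matI) (use v(1) in auto)
    then show False using v(2) by simp
  qed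
  then obtain i where i: "i < Suc m" "v $$ (i, 0) \<noteq> 0" by blast
  let ?S = "swaprows_mat (Suc m) 0 i :: 'a mat"
  have SS: "?S * ?S = 1\<^sub>m (Suc m)" using i by (simp add: swaprows_mat_inv)
  then have "det ?S * det ?S = 1"
    using det_mult[of ?S "Suc m" ?S] by simp
  then have S: "?S \<in> GL (Suc m)" by (auto simp: GL_iff_det)
  define w where "w = ?S * v"
  have w: "w \<in> carrier_mat (Suc m) 1"
    unfolding w_def using v(1) by (intro mult_carrier_mat[of _ _ "Suc m"]) simp_all
  have w0: "w $$ (0, 0) \<noteq> 0"
    unfolding w_def using i v(1) by (subst swaprows_mat[symmetric, of v "Suc m" 1]) auto
  define L where
    "L = mat (Suc m) (Suc m) (\<lambda>(i, j). if j = 0 then w $$ (i, 0) else if i = j then 1 else 0)"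
  have "L \<in> Borel_opp (Suc m)" using w0 by (auto simp: L_def Borel_opp_iff)
  then have L: "L \<in> GL (Suc m)" using Borel_opp_subset_GL by auto
  then have LC: "L \<in> carrier_mat (Suc m) (Suc m)" by (simp add: GL_def)
  have "L * unit_col (Suc m) = w"
  proof (rule eq_matI)
    fix i j assume "i < dim_row w" "j < dim_col w"
    then show "(L * unit_col (Suc m)) $$ (i, j) = w $$ (i, j)"
      using w mult_unit_col_entry[OF LC, of i] by (simp add: L_def)
  qed (use w LC in \<open>auto simp: unit_col_def\<close>)
  then have "?S * L * unit_col (Suc m) = ?S * w"
    using assoc_mult_mat[OF swaprows_mat_carrier LC unit_col_carrier, of 0 i] by simp
  also have "\<dots> = v"
    unfolding w_def using assoc_mult_mat[OF swaprows_mat_carrier swaprows_mat_carrier v(1), of 0 i 0 i]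
      SS v by simp
  finally show ?thesis using that GL_mult[OF S L] by blast
qed

text \<open>Fixing the first basis vector means having it as first column. The determinant is then
  that of the lower right block, while the rest of the top row is arbitrary.\<close>

lemma GL_stabilizer_unit_col:
  "bij_betw (\<lambda>(r, A). four_block_mat (1\<^sub>m 1) r (0\<^sub>m m 1) A)
    (carrier_mat 1 m \<times> GL m) {g \<in> GL (Suc m) :: 'a::field mat set. g * unit_col (Suc m) = unit_col (Suc m)}"
  (is "bij_betw ?f ?X ?Y")
proof (rule bij_betw_imageI)
  show "inj_on ?f ?X"
  proof (rule inj_onI)
    fix x x' assume x: "x \<in> ?X" "x' \<in> ?X" and xx': "?f x = ?f x'"
    obtain r A r' A' where x_eq: "x = (r, A)" "x' = (r', A')"
      by (cases x, cases x')
    have "r \<in> carrier_mat 1 m" "r' \<in> carrier_mat 1 m" "A \<in> GL m" "A' \<in> GL m"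
      and eq: "four_block_mat (1\<^sub>m 1) r (0\<^sub>m m 1) A = four_block_mat (1\<^sub>m 1) r' (0\<^sub>m m 1) A'"
      using x xx' unfolding x_eq by simp_all
    then show "x = x'" unfolding x_eq
      using four_block_mat_inject(2,4)[OF one_carrier_mat one_carrier_mat _ _ zero_carrier_mat
          zero_carrier_mat _ _ eq] by (simp add: GL_def)
  qed
  show "?f ` ?X = ?Y"
  proof (intro equalityI subsetI)
    fix g assume "g \<in> ?f ` ?X"
    then obtain r A where rA: "r \<in> carrier_mat 1 m" "A \<in> GL m"
      and g: "g = four_block_mat (1\<^sub>m 1) r (0\<^sub>m m 1) A" by auto
    have AC: "A \<in> carrier_mat m m" using rA by (simp add: GL_def)
    have gC: "g \<in> carrier_mat (Suc m) (Suc m)"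
      unfolding g using AC four_block_carrier_mat[of "1\<^sub>m 1" 1 1 A m m] by simp
    have "det g = det A"
      unfolding g using det_four_block_mat_lower_left_zero[of "1\<^sub>m 1" 1 r m _ A] rA AC by simp
    then have "g \<in> GL (Suc m)" using rA gC by (simp add: GL_iff_det)
    moreover have "g * unit_col (Suc m) = unit_col (Suc m)"
    proof (rule eq_matI)
      fix i j assume "i < dim_row (unit_col (Suc m) :: 'a mat)" "j < dim_col (unit_col (Suc m) :: 'a mat)"
      then show "(g * unit_col (Suc m)) $$ (i, j) = unit_col (Suc m) $$ (i, j)"
        using mult_unit_col_entry[OF gC, of i] AC by (auto simp: g unit_col_def)
    qed (use gC in \<open>auto simp: unit_col_def\<close>)
    ultimately show "g \<in> ?Y" by simp
  next
    fix g assume "g \<in> ?Y"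
    then have g: "g \<in> GL (Suc m)" and fix_e: "g * unit_col (Suc m) = unit_col (Suc m)" by auto
    have gC: "g \<in> carrier_mat (Suc m) (Suc m)" using g by (simp add: GL_def)
    obtain a r c A where blocks: "a \<in> carrier_mat 1 1" "r \<in> carrier_mat 1 m"
      "c \<in> carrier_mat m 1" "A \<in> carrier_mat m m" "g = four_block_mat a r c A"
      by (rule four_block_mat_cases[of g 1 m 1 m]) (use gC in auto)
    have e: "four_block_mat a r c A $$ (i, 0) = (if i = 0 then 1 else 0)" if "i < Suc m" for i
      using mult_unit_col_entry[OF gC that] that unfolding fix_e blocks(5)[symmetric]
      by (simp add: unit_col_def)
    have "a = 1\<^sub>m 1"
      by (rule eq_matI) (use e[of 0] blocks in auto)
    moreover have "c = 0\<^sub>m m 1"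
    proof (rule eq_matI)
      fix i j assume "i < dim_row (0\<^sub>m m 1 :: 'a mat)" "j < dim_col (0\<^sub>m m 1 :: 'a mat)"
      then show "c $$ (i, j) = 0\<^sub>m m 1 $$ (i, j)" using e[of "Suc i"] blocks by auto
    qed (use blocks in auto)
    ultimately have g_eq: "g = four_block_mat (1\<^sub>m 1) r (0\<^sub>m m 1) A" using blocks by simp
    have "det g = det A"
      unfolding g_eq using det_four_block_mat_lower_left_zero[of "1\<^sub>m 1" 1 r m _ A] blocks by simp
    then have "A \<in> GL m" using g blocks by (simp add: GL_iff_det)
    then show "g \<in> ?f ` ?X" using g_eq blocks by (intro image_eqI[of _ _ "(r, A)"]) auto
  qed
qed

text \<open>Orbit counting: the group acts transitively on the nonzero columns, so every fibre of
  the orbit map has as many elements as the stabilizer of the first basis vector.\<close>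

lemma card_GL_Suc:
  "card (GL (Suc m) :: 'a::{field,finite} mat set) =
    (CARD('a) ^ Suc m - 1) * (CARD('a) ^ m * card (GL m :: 'a mat set))"
proof -
  let ?e = "unit_col (Suc m) :: 'a mat"
  let ?V = "carrier_mat (Suc m) 1 - {0\<^sub>m (Suc m) 1} :: 'a mat set"
  let ?H = "\<lambda>v. {g \<in> GL (Suc m). g * ?e = v}"
  have finV: "finite ?V" by (simp add: finite_carrier_mat)
  have e0: "?e \<noteq> 0\<^sub>m (Suc m) 1"
  proof
    assume "?e = 0\<^sub>m (Suc m) 1"
    then have "?e $$ (0, 0) = 0\<^sub>m (Suc m) 1 $$ (0, 0)" by simp
    then show False by (simp add: unit_col_def)
  qed
  have image: "(\<lambda>g. g * ?e) ` GL (Suc m) \<subseteq> ?V"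
  proof clarify
    fix g :: "'a mat" assume g: "g \<in> GL (Suc m)"
    then have gC: "g \<in> carrier_mat (Suc m) (Suc m)" by (simp add: GL_def)
    have "g * ?e \<noteq> 0\<^sub>m (Suc m) 1"
    proof
      assume "g * ?e = 0\<^sub>m (Suc m) 1"
      then have "g * ?e = g * 0\<^sub>m (Suc m) 1" using gC by simp
      then show False using GL_mult_cancel_left[OF g unit_col_carrier zero_carrier_mat] e0 by blast
    qed
    then show "g * ?e \<in> ?V" using mult_carrier_mat[OF gC unit_col_carrier] by blast
  qed
  have fibre: "card (?H v) = CARD('a) ^ m * card (GL m :: 'a mat set)" if v: "v \<in> ?V" for v
  proof -
    obtain P where P: "P \<in> GL (Suc m)" "P * ?e = v"
      using GL_transitive[of v m] v by blast
    have PC: "P \<in> carrier_mat (Suc m) (Suc m)" using P by (simp add: GL_def)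
    obtain Q where Q: "Q \<in> carrier_mat (Suc m) (Suc m)" "P * Q = 1\<^sub>m (Suc m)" "Q * P = 1\<^sub>m (Suc m)"
      using GL_obtain_inverse[OF P(1)] .
    have "det Q \<noteq> 0" using det_mult[OF PC Q(1)] Q(2) by auto
    then have QG: "Q \<in> GL (Suc m)" using Q(1) by (simp add: GL_iff_det)
    have Qv: "Q * v = ?e"
      unfolding P(2)[symmetric] assoc_mult_mat[OF Q(1) PC unit_col_carrier, symmetric] Q(3)
      by (rule left_mult_one_mat[OF unit_col_carrier])
    \<comment> \<open>Left multiplication by \<open>P\<close> maps the stabilizer onto the fibre
      over \<open>v\<close>, and its inverse \<open>Q\<close> leads back.\<close>
    have "bij_betw (\<lambda>g. P * g) (?H ?e) (?H v)"
    proof (rule bij_betw_byWitness[where f' = "\<lambda>g. Q * g"])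
      show "\<forall>g\<in>?H ?e. Q * (P * g) = g"
        using assoc_mult_mat[OF Q(1) PC] Q(3) by (auto simp: GL_def)
      show "\<forall>g\<in>?H v. P * (Q * g) = g"
        using assoc_mult_mat[OF PC Q(1)] Q(2) by (auto simp: GL_def)
      show "(\<lambda>g. P * g) ` ?H ?e \<subseteq> ?H v"
      proof clarify
        fix g :: "'a mat" assume g: "g \<in> GL (Suc m)" "g * ?e = ?e"
        then have gC: "g \<in> carrier_mat (Suc m) (Suc m)" by (simp add: GL_def)
        show "P * g \<in> GL (Suc m) \<and> P * g * ?e = v"
          using GL_mult[OF P(1) g(1)] assoc_mult_mat[OF PC gC unit_col_carrier] g(2) P(2) by simp
      qed
      show "(\<lambda>g. Q * g) ` ?H v \<subseteq> ?H ?e"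
      proof clarify
        fix g :: "'a mat" assume g: "g \<in> GL (Suc m)" "v = g * ?e"
        then have gC: "g \<in> carrier_mat (Suc m) (Suc m)" by (simp add: GL_def)
        show "Q * g \<in> GL (Suc m) \<and> Q * g * ?e = ?e"
          using GL_mult[OF QG g(1)] assoc_mult_mat[OF Q(1) gC unit_col_carrier] g(2) Qv by simp
      qed
    qed
    then have "card (?H v) = card (?H ?e)" by (rule bij_betw_same_card[symmetric])
    also have "\<dots> = CARD('a) ^ m * card (GL m :: 'a mat set)"
      using bij_betw_same_card[OF GL_stabilizer_unit_col[where 'a = 'a and m = m]]
      by (simp add: card_cartesian_product card_carrier_mat)
    finally show ?thesis .
  qed
  have "card (GL (Suc m) :: 'a mat set) = (\<Sum>g\<in>(GL (Suc m) :: 'a mat set). 1)" by simp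
  also have "\<dots> = (\<Sum>v\<in>?V. \<Sum>g\<in>?H v. 1)"
    by (rule sum.group[OF finite_GL finV image, symmetric])
  also have "\<dots> = (\<Sum>v\<in>?V. CARD('a) ^ m * card (GL m :: 'a mat set))"
    by (rule sum.cong) (use fibre in auto)
  also have "\<dots> = (CARD('a) ^ Suc m - 1) * (CARD('a) ^ m * card (GL m :: 'a mat set))"
    by (simp add: card_Diff_subset card_carrier_mat)
  finally show ?thesis .
qed

text \<open>Both orders contain the factor \<open>CARD('a) ^ m\<close>, which cancels. The ratio is
  the reciprocal of the index of the Borel subgroup; its growth is the part (q - 1) / (q^n - 1) of
  the constant.\<close>

lemma card_index_ratio_Suc:
  "of_nat (card (Borel_opp (Suc m) :: 'a::{field,finite} mat set)) /
     of_nat (card (GL (Suc m) :: 'a mat set)) =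
   (of_nat CARD('a) - 1) / (of_nat CARD('a) ^ Suc m - 1) *
     (of_nat (card (Borel_opp m :: 'a mat set)) / of_nat (card (GL m :: 'a mat set)) :: complex)"
proof -
  have "CARD('a) ^ Suc m \<ge> 1" by simp
  then show ?thesis
    unfolding card_GL_Suc card_Borel_opp_Suc by (simp add: of_nat_diff del: power_Suc)
qed

section \<open>Unipotent matrices\<close>

lemma Unip_mult_entry:
  assumes u: "u \<in> Unip m" and v: "v \<in> Unip m" and ij: "i < m" "j < m"
  shows "(u * v) $$ (i, j) = (\<Sum>k\<in>{i..j}. u $$ (i, k) * v $$ (k, j))"
proof -
  have "(u * v) $$ (i, j) = (\<Sum>k<m. u $$ (i, k) * v $$ (k, j))"
    using Unip_carrier[OF u] Unip_carrier[OF v] ij by (simp add: scalar_prod_def atLeast0LessThan)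
  also have "\<dots> = (\<Sum>k\<in>{i..j}. u $$ (i, k) * v $$ (k, j))"
  proof (rule sum.mono_neutral_right)
    show "\<forall>k\<in>{..<m} - {i..j}. u $$ (i, k) * v $$ (k, j) = 0"
      using u v ij by (auto simp: Unip_iff upper_triangular_def)
  qed (use ij in auto)
  finally show ?thesis .
qed

lemma Unip_mult:
  assumes "u \<in> Unip m" "v \<in> Unip m"
  shows "u * v \<in> Unip m"
proof -
  have "upper_triangular (u * v)"
    using assms Unip_carrier[OF assms(1)] Unip_mult_entry[OF assms]
    by (auto simp: upper_triangular_def)
  moreover have "(u * v) $$ (i, i) = 1" if "i < m" for i
    using assms Unip_mult_entry[OF assms that that] that by (simp add: Unip_iff)
  ultimately show ?thesis
    using Unip_carrier[OF assms(1)] Unip_carrier[OF assms(2)] by (simp add: Unip_iff)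
qed

text \<open>No index lies strictly between \<open>i\<close> and \<open>Suc i\<close>, so a
  superdiagonal entry of the product has just two terms, and superdiagonals add.\<close>

lemma unip_character_mult:
  assumes "additive_character \<psi>" "u \<in> Unip m" "v \<in> Unip m"
  shows "unip_character \<psi> m (u * v) = unip_character \<psi> m u * unip_character \<psi> m v"
proof -
  have "(u * v) $$ (i, Suc i) = u $$ (i, Suc i) + v $$ (i, Suc i)" if "i < m - 1" for i
    using Unip_mult_entry[OF assms(2,3), of i "Suc i"] assms(2,3) that
    by (simp add: Unip_iff atLeastAtMostSuc_conv add.commute)
  then have "(\<Sum>i<m - 1. (u * v) $$ (i, Suc i)) =
      (\<Sum>i<m - 1. u $$ (i, Suc i)) + (\<Sum>i<m - 1. v $$ (i, Suc i))"
    by (simp add: sum.distrib[symmetric])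
  then show ?thesis using assms(1) by (simp add: unip_character_def additive_character_def)
qed

text \<open>Transposition turns \<open>u\<close> into a lower triangular matrix, whose left inverse
  is already available; comparing diagonals shows that this inverse is unipotent.\<close>

lemma Unip_right_inverse:
  fixes u :: "'a::{field,finite} mat"
  assumes u: "u \<in> Unip m"
  obtains v where "v \<in> Unip m" "u * v = 1\<^sub>m m"
proof -
  have uC: "u \<in> carrier_mat m m" using u by (rule Unip_carrier)
  have uT: "transpose_mat u \<in> Borel_opp m"
    using u by (auto simp: Borel_opp_iff Unip_iff upper_triangular_def)
  obtain c where c: "c \<in> Borel_opp m" "c * transpose_mat u = 1\<^sub>m m"
    using Borel_opp_left_inverse[OF uT] .
  have cC: "c \<in> carrier_mat m m" using c(1) by (rule Borel_opp_carrier)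
  have "u * transpose_mat c = transpose_mat (c * transpose_mat u)"
    using uC cC by (subst transpose_mult[of _ m m _ m]) auto
  then have "u * transpose_mat c = 1\<^sub>m m" using c(2) by simp
  moreover have "transpose_mat c \<in> Unip m"
    unfolding Unip_iff
  proof (intro conjI allI impI)
    fix i assume i: "i < m"
    have "c $$ (i, i) * transpose_mat u $$ (i, i) = 1"
      using Borel_opp_mult(2)[OF c(1) uT i] c(2) i by simp
    then show "transpose_mat c $$ (i, i) = 1" using u uC cC i by (simp add: Unip_iff)
  qed (use c(1) cC in \<open>auto simp: Borel_opp_iff upper_triangular_def\<close>)
  ultimately show ?thesis using that by blast
qed

text \<open>The open cell is stable under right multiplication by \<open>u\<close> and by its
  inverse, so \<open>g\<close> and \<open>g * u\<close> are both inside it or both outside. This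
  rule later extracts the shear factor.\<close>

lemma whittaker_vector_mult_Unip:
  fixes u g :: "'a::{field,finite} mat"
  assumes \<psi>: "additive_character \<psi>" and u: "u \<in> Unip m" and g: "g \<in> carrier_mat m m"
  shows "whittaker_vector \<psi> \<chi> m (g * u) = whittaker_vector \<psi> \<chi> m g * unip_character \<psi> m u"
proof (cases "\<exists>b\<in>Borel_opp m. \<exists>w\<in>Unip m. g = b * w")
  case True
  then obtain b w where b: "b \<in> Borel_opp m" and w: "w \<in> Unip m" and g_eq: "g = b * w" by blast
  have "g * u = b * (w * u)"
    unfolding g_eq using assoc_mult_mat[OF Borel_opp_carrier[OF b] Unip_carrier[OF w] Unip_carrier[OF u]] .
  then show ?thesis
    using whittaker_vector_factor[OF b Unip_mult[OF w u], of \<psi> \<chi>] whittaker_vector_factor[OF b w, of \<psi> \<chi>]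
      unip_character_mult[OF \<psi> w u] g_eq by simp
next
  case False
  obtain v where v: "v \<in> Unip m" "u * v = 1\<^sub>m m" using Unip_right_inverse[OF u] .
  have "g * u \<noteq> b * w" if b: "b \<in> Borel_opp m" and w: "w \<in> Unip m" for b w
  proof
    assume "g * u = b * w"
    then have "g * u * v = b * w * v" by simp
    moreover have "g * u * v = g"
      using assoc_mult_mat[OF g Unip_carrier[OF u] Unip_carrier[OF v(1)]] v(2) g by simp
    moreover have "b * w * v = b * (w * v)"
      using assoc_mult_mat[OF Borel_opp_carrier[OF b] Unip_carrier[OF w] Unip_carrier[OF v(1)]] .
    ultimately show False using False b Unip_mult[OF w v(1)] by metis
  qed
  then have "whittaker_vector \<psi> \<chi> m (g * u) = 0" by (intro whittaker_vector_outside)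
  moreover have "whittaker_vector \<psi> \<chi> m g = 0"
    using False by (intro whittaker_vector_outside) blast
  ultimately show ?thesis by simp
qed

text \<open>Writing the last column as \<open>u * c\<close> instead of \<open>c\<close> loses
  nothing, since \<open>u\<close> is invertible, and lets \<open>u\<close> factor out on the left of
  the leading block later.\<close>

lemma Unip_Suc:
  "bij_betw (\<lambda>(u, c). four_block_mat u (u * c) (0\<^sub>m 1 m) (1\<^sub>m 1))
    (Unip m \<times> carrier_mat m 1) (Unip (Suc m) :: 'a::{field,finite} mat set)"
  (is "bij_betw ?f ?X _")
proof (rule bij_betw_imageI)
  show "inj_on ?f ?X"
  proof (rule inj_onI)
    fix x x' assume x: "x \<in> ?X" "x' \<in> ?X" and xx': "?f x = ?f x'"
    obtain u c u' c' where x_eq: "x = (u, c)" "x' = (u', c')"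
      by (cases x, cases x')
    have u: "u \<in> Unip m" "u' \<in> Unip m" and c: "c \<in> carrier_mat m 1" "c' \<in> carrier_mat m 1"
      and eq: "four_block_mat u (u * c) (0\<^sub>m 1 m) (1\<^sub>m 1) = four_block_mat u' (u' * c') (0\<^sub>m 1 m) (1\<^sub>m 1)"
      using x xx' unfolding x_eq by (simp_all only: mem_Sigma_iff case_prod_conv)
    note uc = mult_carrier_mat[OF Unip_carrier[OF u(1)] c(1)] mult_carrier_mat[OF Unip_carrier[OF u(2)] c(2)]
    note inj = four_block_mat_inject[OF u[THEN Unip_carrier] uc zero_carrier_mat zero_carrier_mat
        one_carrier_mat one_carrier_mat eq]
    have "u \<in> GL m" using u Unip_subset_GL by auto
    moreover have "u * c = u * c'" using inj(2) unfolding inj(1)[symmetric] .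
    ultimately have "c = c'" by (rule GL_mult_cancel_left[OF _ c])
    then show "x = x'" using inj(1) by (simp add: x_eq)
  qed
  show "?f ` ?X = Unip (Suc m)"
  proof (intro equalityI subsetI)
    fix A assume "A \<in> ?f ` ?X"
    then obtain u c where u: "u \<in> Unip m" and c: "c \<in> carrier_mat m 1"
      and A: "A = four_block_mat u (u * c) (0\<^sub>m 1 m) (1\<^sub>m 1)" by auto
    have uC: "u \<in> carrier_mat m m" using u by (rule Unip_carrier)
    then show "A \<in> Unip (Suc m)"
      using u c unfolding A by (auto simp: Unip_iff upper_triangular_def less_Suc_eq)
  next
    fix A :: "'a mat" assume A: "A \<in> Unip (Suc m)"
    obtain u s r d where blocks: "u \<in> carrier_mat m m" "s \<in> carrier_mat m 1"
      "r \<in> carrier_mat 1 m" "d \<in> carrier_mat 1 1" "A = four_block_mat u s r d"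
      by (rule four_block_mat_cases[of A m 1 m 1]) (use Unip_carrier[OF A] in auto)
    have e: "A $$ (i, j) = four_block_mat u s r d $$ (i, j)" for i j using blocks by simp
    have A0: "A $$ (i, j) = 0" if "i < Suc m" "j < i" for i j
      using A Unip_carrier[OF A] that by (simp add: Unip_iff upper_triangular_def)
    have A1: "A $$ (i, i) = 1" if "i < Suc m" for i using A that by (simp add: Unip_iff)
    have "r = 0\<^sub>m 1 m"
    proof (rule eq_matI)
      fix i j assume "i < dim_row (0\<^sub>m 1 m :: 'a mat)" "j < dim_col (0\<^sub>m 1 m :: 'a mat)"
      then show "r $$ (i, j) = 0\<^sub>m 1 m $$ (i, j)"
        using A0[of m j] e[of m j] blocks(1-4) by simp
    qed (use blocks in auto)
    moreover have "d = 1\<^sub>m 1"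
      by (rule eq_matI) (use A1[of m] e[of m m] blocks(1-4) in auto)
    moreover have u: "u \<in> Unip m"
      unfolding Unip_iff upper_triangular_def
    proof (intro conjI allI impI)
      fix i j assume "i < dim_row u" "j < i"
      then show "u $$ (i, j) = 0" using A0[of i j] e[of i j] blocks(1-4) by simp
    next
      fix i assume "i < m"
      then show "u $$ (i, i) = 1" using A1[of i] e[of i i] blocks(1-4) by simp
    qed (use blocks in auto)
    \<comment> \<open>The preimage needs a column \<open>c\<close> with \<open>u * c = s\<close>,
      which a right inverse of \<open>u\<close> provides.\<close>
    moreover obtain v where v: "v \<in> Unip m" "u * v = 1\<^sub>m m" using Unip_right_inverse[OF u] .
    have "u * (v * s) = s"
      using assoc_mult_mat[OF Unip_carrier[OF u] Unip_carrier[OF v(1)] blocks(2)] v(2) blocks(2) by simp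
    moreover have "v * s \<in> carrier_mat m 1"
      using mult_carrier_mat[OF Unip_carrier[OF v(1)] blocks(2)] .
    ultimately show "A \<in> ?f ` ?X"
      using blocks(5) by (intro image_eqI[of _ _ "(u, v * s)"]) auto
  qed
qed

lemma unip_character_four_block:
  assumes \<psi>: "additive_character \<psi>" and m: "m \<ge> 1"
    and u: "u \<in> carrier_mat m m" and y: "y \<in> carrier_mat m 1"
  shows "unip_character \<psi> (Suc m) (four_block_mat u y (0\<^sub>m 1 m) (1\<^sub>m 1)) =
    unip_character \<psi> m u * \<psi> (y $$ (m - 1, 0))"
proof -
  let ?U = "four_block_mat u y (0\<^sub>m 1 m) (1\<^sub>m 1)"
  obtain k where k: "m = Suc k" using m by (cases m) auto
  have "(\<Sum>i<k. ?U $$ (i, Suc i)) = (\<Sum>i<k. u $$ (i, Suc i))"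
    by (rule sum.cong) (use u y k in auto)
  moreover have "?U $$ (k, Suc k) = y $$ (k, 0)" using u y k by simp
  ultimately have "(\<Sum>i<Suc k. ?U $$ (i, Suc i)) = (\<Sum>i<k. u $$ (i, Suc i)) + y $$ (k, 0)"
    by simp
  then show ?thesis using \<psi> k by (simp add: unip_character_def additive_character_def)
qed

lemma borel_character_four_block:
  assumes "b \<in> carrier_mat m m"
  shows "borel_character \<chi> (Suc m) (four_block_mat b s r (d \<cdot>\<^sub>m 1\<^sub>m 1)) =
    borel_character \<chi> m b * \<chi> (Suc m) d"
  using assms by (simp add: borel_character_def)

section \<open>Bordered matrices in the open cell\<close>

text \<open>The upper right block of \<open>B\<close> and the lower left block of \<open>W\<close>
  vanish, so the leading block of \<open>B * W\<close> is the product of the leading blocks. It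
  serves to show that a Whittaker vector vanishes.\<close>

lemma Borel_opp_Unip_top_left:
  fixes M :: "'a::{field,finite} mat"
  assumes M: "M \<in> carrier_mat m m" and s: "s \<in> carrier_mat m 1"
    and r: "r \<in> carrier_mat 1 m" and d: "d \<in> carrier_mat 1 1"
    and B: "B \<in> Borel_opp (Suc m)" and W: "W \<in> Unip (Suc m)"
    and eq: "four_block_mat M s r d = B * W"
  obtains b w where "b \<in> Borel_opp m" "w \<in> Unip m" "M = b * w"
proof -
  obtain b r' d' where b: "b \<in> Borel_opp m" and r': "r' \<in> carrier_mat 1 m"
    and B_eq: "B = four_block_mat b (0\<^sub>m m 1) r' (d' \<cdot>\<^sub>m 1\<^sub>m 1)"
    using B unfolding bij_betw_imp_surj_on[OF Borel_opp_Suc[of m], symmetric] by auto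
  obtain w c where w: "w \<in> Unip m" and c: "c \<in> carrier_mat m 1"
    and W_eq: "W = four_block_mat w (w * c) (0\<^sub>m 1 m) (1\<^sub>m 1)"
    using W unfolding bij_betw_imp_surj_on[OF Unip_Suc[of m], symmetric] by auto
  note bC = Borel_opp_carrier[OF b] and wC = Unip_carrier[OF w]
  have wc: "w * c \<in> carrier_mat m 1" using mult_carrier_mat[OF wC c] .
  have d': "d' \<cdot>\<^sub>m 1\<^sub>m 1 \<in> carrier_mat 1 1" by simp
  have "M = b * w + 0\<^sub>m m 1 * 0\<^sub>m 1 m"
    by (rule four_block_mat_inject(1)[OF M _ s _ r _ d _
        eq[unfolded B_eq W_eq mult_four_block_mat[OF bC zero_carrier_mat r' d' wC wc zero_carrier_mat one_carrier_mat]]])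
      (use bC wC r' wc in auto)
  also have "\<dots> = b * w" using mult_carrier_mat[OF bC wC] by simp
  finally show ?thesis using that b w by blast
qed

text \<open>The last standard basis row, which becomes the lower left block when a bordered
  unipotent matrix is multiplied by \<open>antidiag_block (Suc m) a 1\<close>.\<close>

definition last_row :: "nat \<Rightarrow> 'a::zero_neq_one mat" where
  "last_row m = mat 1 m (\<lambda>(i, j). if j = m - 1 then 1 else 0)"

lemma last_row_carrier [simp]: "last_row m \<in> carrier_mat 1 m"
  by (simp add: last_row_def)

lemma last_row_mult_entry:
  fixes A :: "'a::field mat"
  assumes "m \<ge> 1" "A \<in> carrier_mat m n" "j < n"
  shows "(last_row m * A) $$ (0, j) = A $$ (m - 1, j)"
proof -
  have "(last_row m * A) $$ (0, j) = (\<Sum>k\<in>{0..<m}. (if k = m - 1 then 1 else 0) * A $$ (k, j))"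
    using assms by (simp add: scalar_prod_def last_row_def)
  also have "\<dots> = (\<Sum>k\<in>{0..<m}. if k = m - 1 then A $$ (k, j) else 0)"
    by (rule sum.cong) auto
  also have "\<dots> = A $$ (m - 1, j)" using assms by (subst sum.delta) auto
  finally show ?thesis .
qed

text \<open>An upper unipotent matrix ends with this very row. Consequently left multiplication by
  \<open>u\<close> preserves the last entry of a column, which controls the new superdiagonal
  entry.\<close>

lemma last_row_mult_Unip:
  fixes u :: "'a::field mat"
  assumes "m \<ge> 1" "u \<in> Unip m"
  shows "last_row m * u = last_row m"
proof (rule eq_matI)
  fix i j assume "i < dim_row (last_row m :: 'a mat)" "j < dim_col (last_row m :: 'a mat)"
  then show "(last_row m * u) $$ (i, j) = last_row m $$ (i, j)"
    using assms last_row_mult_entry[OF assms(1) Unip_carrier[OF assms(2)], of j]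
    by (auto simp: last_row_def Unip_iff upper_triangular_def)
qed (use Unip_carrier[OF assms(2)] in \<open>auto simp: last_row_def\<close>)

text \<open>A factorisation \<open>M = b * w\<close> extends to the bordered matrix: the new column
  of the unipotent factor must be \<open>w * z\<close>, whose last entry is again \<open>x\<close>,
  the new row of the lower triangular factor is \<open>last_row m\<close>, and the zero corner
  forces the diagonal entry \<open>- x\<close>. If \<open>M\<close> has no factorisation, neither
  has the bordered matrix.\<close>

lemma whittaker_vector_four_block:
  fixes M :: "'a::{field,finite} mat"
  assumes \<psi>: "additive_character \<psi>" and m: "m \<ge> 1" and M: "M \<in> carrier_mat m m"
    and z: "z \<in> carrier_mat m 1" and z_last: "z $$ (m - 1, 0) = x" "x \<noteq> 0"
  shows "whittaker_vector \<psi> \<chi> (Suc m) (four_block_mat M (M * z) (last_row m) (0\<^sub>m 1 1)) =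
    \<chi> (Suc m) (- x) * \<psi> x * whittaker_vector \<psi> \<chi> m M"
proof (cases "\<exists>b\<in>Borel_opp m. \<exists>w\<in>Unip m. M = b * w")
  case True
  then obtain b w where b: "b \<in> Borel_opp m" and w: "w \<in> Unip m" and M_eq: "M = b * w" by blast
  note bC = Borel_opp_carrier[OF b] and wC = Unip_carrier[OF w]
  have wz: "w * z \<in> carrier_mat m 1" using mult_carrier_mat[OF wC z] .
  have row_wz: "last_row m * (w * z) = last_row m * z"
    using assoc_mult_mat[OF last_row_carrier wC z] last_row_mult_Unip[OF m w] by simp
  have wz_last: "(w * z) $$ (m - 1, 0) = x"
    using last_row_mult_entry[OF m wz, of 0] last_row_mult_entry[OF m z, of 0] row_wz z_last by simp
  let ?B = "four_block_mat b (0\<^sub>m m 1) (last_row m) ((- x) \<cdot>\<^sub>m 1\<^sub>m 1)"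
  let ?W = "four_block_mat w (w * z) (0\<^sub>m 1 m) (1\<^sub>m 1)"
  have B: "?B \<in> Borel_opp (Suc m)"
    by (subst bij_betw_imp_surj_on[OF Borel_opp_Suc[of m], symmetric],
        rule image_eqI[of _ _ "(b, last_row m, - x)"]) (use b z_last(2) in \<open>simp_all add: last_row_def\<close>)
  have W: "?W \<in> Unip (Suc m)"
    by (subst bij_betw_imp_surj_on[OF Unip_Suc[of m], symmetric],
        rule image_eqI[of _ _ "(w, z)"]) (use w z in simp_all)
  have xC: "(- x) \<cdot>\<^sub>m 1\<^sub>m 1 \<in> carrier_mat 1 1" by simp
  have corner: "last_row m * (w * z) + (- x) \<cdot>\<^sub>m 1\<^sub>m 1 * 1\<^sub>m 1 = 0\<^sub>m 1 1"
  proof -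
    have "last_row m * (w * z) = x \<cdot>\<^sub>m 1\<^sub>m 1"
      using mat_1_1_eq[OF mult_carrier_mat[OF last_row_carrier wz]]
        last_row_mult_entry[OF m wz, of 0] wz_last by simp
    then show ?thesis by (intro eq_matI) auto
  qed
  have "?B * ?W = four_block_mat M (M * z) (last_row m) (0\<^sub>m 1 1)"
    unfolding mult_four_block_mat[OF bC zero_carrier_mat last_row_carrier xC wC wz zero_carrier_mat one_carrier_mat]
      corner last_row_mult_Unip[OF m w]
    using bC wC z assoc_mult_mat[OF bC wC z]
    by (simp add: M_eq last_row_carrier[unfolded One_nat_def])
  then show ?thesis
    using whittaker_vector_factor[OF B W, of \<psi> \<chi>] whittaker_vector_factor[OF b w, of \<psi> \<chi>]
      unip_character_four_block[OF \<psi> m wC wz] borel_character_four_block[OF bC] wz_last M_eq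
    by simp
next
  case False
  then have "whittaker_vector \<psi> \<chi> m M = 0" by (intro whittaker_vector_outside) blast
  moreover have "whittaker_vector \<psi> \<chi> (Suc m) (four_block_mat M (M * z) (last_row m) (0\<^sub>m 1 1)) = 0"
  proof (rule whittaker_vector_outside, rule notI)
    fix B W :: "'a mat" assume B: "B \<in> Borel_opp (Suc m)" and W: "W \<in> Unip (Suc m)"
      and eq: "four_block_mat M (M * z) (last_row m) (0\<^sub>m 1 1) = B * W"
    obtain b w where "b \<in> Borel_opp m" "w \<in> Unip m" "M = b * w"
      by (rule Borel_opp_Unip_top_left[OF M mult_carrier_mat[OF M z] last_row_carrier
            zero_carrier_mat B W eq])
    then show False using False by blast
  qed
  ultimately show ?thesis by simp
qed

section \<open>The recursion\<close>

lemma antidiag_block_index: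
  fixes c1 c2 :: "'a::field"
  assumes "i < m" "j < m"
  shows "antidiag_block m c1 c2 $$ (i, j) =
    (if j = m - 1 then (if i = 0 then c1 else 0) else if i = Suc j then c2 else 0)"
  using assms by (auto simp: antidiag_block_def)

lemma det_antidiag_block:
  fixes c1 c2 :: "'a::field"
  assumes "m \<ge> 1"
  shows "det (antidiag_block m c1 c2) = (- 1) ^ (m - 1) * c1 * c2 ^ (m - 1)"
  unfolding antidiag_block_def
  by (subst det_four_block_mat_lower_right_zero_col[of _ "m - 1"]) (auto simp: det_smult)

lemma antidiag_block_GL:
  fixes c1 c2 :: "'a::field"
  assumes "m \<ge> 1"
  shows "antidiag_block m c1 c2 \<in> GL m \<longleftrightarrow> c1 \<noteq> 0 \<and> (m = 1 \<or> c2 \<noteq> 0)"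
  using assms antidiag_block_carrier[OF assms] by (auto simp: GL_iff_det det_antidiag_block)

lemma mult_antidiag_block_index:
  fixes A :: "'a::field mat"
  assumes A: "A \<in> carrier_mat m m" and ij: "i < m" "j < m"
  shows "(A * antidiag_block m a 1) $$ (i, j) =
    (if j = m - 1 then a * A $$ (i, 0) else A $$ (i, Suc j))"
proof -
  have m: "m \<ge> 1" using ij by simp
  have "(A * antidiag_block m a 1) $$ (i, j) = (\<Sum>k\<in>{0..<m}. A $$ (i, k) * antidiag_block m a 1 $$ (k, j))"
    using A ij antidiag_block_carrier[OF m, of a 1] by (simp add: scalar_prod_def)
  also have "\<dots> = (\<Sum>k\<in>{0..<m}. if k = (if j = m - 1 then 0 else Suc j)
      then (if j = m - 1 then a * A $$ (i, k) else A $$ (i, k)) else 0)"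
    by (rule sum.cong) (use ij in \<open>auto simp: antidiag_block_index\<close>)
  also have "\<dots> = (if j = m - 1 then a * A $$ (i, 0) else A $$ (i, Suc j))"
    using ij by (subst sum.delta) auto
  finally show ?thesis .
qed

text \<open>
  The columns of \<open>companion_block m c\<close> are \<open>e\<^sub>1, \<dots>, e\<^sub>m\<^sub>-\<^sub>1, c\<close>. For \<open>u \<in> U\<^sub>m\<close>,
  \<open>u * companion_block m c\<close> is the leading block of \<open>u' g\<^sub>1\<^sub>,\<^sub>m(a,1)\<close>, where \<open>u'\<close> is the extension of \<open>u\<close>
  with last column \<open>u c\<close>.
\<close>

definition companion_block :: "nat \<Rightarrow> 'a::zero_neq_one mat \<Rightarrow> 'a mat" where
  "companion_block m c =
     mat m m (\<lambda>(i, j). if j = m - 1 then c $$ (i, 0) else if i = Suc j then 1 else 0)"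

text \<open>The unipotent matrix N of the overview. The index \<open>Suc i\<close> anticipates the
  downward row shift caused by \<open>antidiag_block\<close> on the left; since the diagonal is
  tested first, \<open>c\<close> is never read beyond its last entry.\<close>

definition shear_block :: "nat \<Rightarrow> 'a::zero_neq_one mat \<Rightarrow> 'a mat" where
  "shear_block m c =
     mat m m (\<lambda>(i, j). if i = j then 1 else if j = m - 1 then c $$ (Suc i, 0) else 0)"

lemma companion_block_carrier [simp]: "companion_block m c \<in> carrier_mat m m"
  by (simp add: companion_block_def)

lemma shear_block_Unip: "shear_block m c \<in> Unip m"
  by (auto simp: shear_block_def Unip_iff upper_triangular_def)

text \<open>The only superdiagonal position in the last column is in row \<open>m - 2\<close>, and
  its entry is the last one of \<open>c\<close>. This position exists only for
  \<open>m \<ge> 2\<close>, which is where the bound \<open>n \<ge> 3\<close> matters.\<close>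

lemma unip_character_shear_block:
  assumes "m \<ge> 2"
  shows "unip_character \<psi> m (shear_block m c) = \<psi> (c $$ (m - 1, 0))"
proof -
  obtain k where k: "m = Suc (Suc k)" using assms by (metis Suc_le_D numeral_2_eq_2 Suc_le_mono)
  have "(\<Sum>i<k. shear_block m c $$ (i, Suc i)) = 0"
    by (rule sum.neutral) (auto simp: shear_block_def k)
  then have "(\<Sum>i<m - 1. shear_block m c $$ (i, Suc i)) = c $$ (m - 1, 0)"
    by (simp add: k shear_block_def)
  then show ?thesis by (simp add: unip_character_def)
qed

text \<open>Separates the first entry of \<open>c\<close>, which becomes the parameter of the
  smaller antidiagonal matrix, from the others, which form a right unipotent factor.\<close>

lemma antidiag_block_mult_shear_block:
  fixes c :: "'a::field mat"
  assumes "m \<ge> 1"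
  shows "antidiag_block m (c $$ (0, 0)) 1 * shear_block m c = companion_block m c"
proof (rule eq_matI)
  fix i j assume "i < dim_row (companion_block m c)" "j < dim_col (companion_block m c)"
  then have ij: "i < m" "j < m" by (simp_all add: companion_block_def)
  have "(antidiag_block m (c $$ (0, 0)) 1 * shear_block m c) $$ (i, j) =
      (\<Sum>k\<in>{0..<m}. antidiag_block m (c $$ (0, 0)) 1 $$ (i, k) * shear_block m c $$ (k, j))"
    using ij antidiag_block_carrier[OF assms, of "c $$ (0, 0)" 1]
    by (simp add: scalar_prod_def shear_block_def)
  \<comment> \<open>Each row of the antidiagonal matrix has one possibly nonzero entry: in the last
    column for row 0, and in column \<open>i - 1\<close> for the other rows.\<close>
  also have "\<dots> = (\<Sum>k\<in>{0..<m}. if k = (if i = 0 then m - 1 else i - 1)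
      then (if i = 0 then c $$ (0, 0) else 1) * shear_block m c $$ (k, j) else 0)"
    by (rule sum.cong) (use ij in \<open>auto simp: antidiag_block_index\<close>)
  also have "\<dots> = companion_block m c $$ (i, j)"
    using ij by (subst sum.delta) (auto simp: shear_block_def companion_block_def)
  finally show "(antidiag_block m (c $$ (0, 0)) 1 * shear_block m c) $$ (i, j) =
    companion_block m c $$ (i, j)" .
qed (use antidiag_block_carrier[OF assms, of "c $$ (0, 0)" 1] in
      \<open>auto simp: companion_block_def shear_block_def\<close>)

lemma mult_companion_block_index:
  fixes A :: "'a::field mat"
  assumes A: "A \<in> carrier_mat n m" and c: "c \<in> carrier_mat m 1" and ij: "i < n" "j < m"
  shows "(A * companion_block m c) $$ (i, j) =
    (if j = m - 1 then (A * c) $$ (i, 0) else A $$ (i, Suc j))"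
proof -
  have entry: "(A * companion_block m c) $$ (i, j) =
      (\<Sum>k\<in>{0..<m}. A $$ (i, k) * companion_block m c $$ (k, j))"
    using A ij by (simp add: scalar_prod_def companion_block_def)
  show ?thesis
  proof (cases "j = m - 1")
    case True
    have "(A * c) $$ (i, 0) = (\<Sum>k\<in>{0..<m}. A $$ (i, k) * c $$ (k, 0))"
      using A c ij by (simp add: scalar_prod_def)
    also have "\<dots> = (A * companion_block m c) $$ (i, j)"
      unfolding entry by (rule sum.cong) (use True ij in \<open>auto simp: companion_block_def\<close>)
    finally show ?thesis using True by simp
  next
    case False
    have "(\<Sum>k\<in>{0..<m}. A $$ (i, k) * companion_block m c $$ (k, j)) =
        (\<Sum>k\<in>{0..<m}. if k = Suc j then A $$ (i, k) else 0)"
      by (rule sum.cong) (use False ij in \<open>auto simp: companion_block_def\<close>)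
    also have "\<dots> = A $$ (i, Suc j)" using False ij by (subst sum.delta) auto
    finally show ?thesis using False entry by simp
  qed
qed

text \<open>The antidiagonal matrix shifts all columns one place to the left and appends
  \<open>a\<close> times the first one, which is a basis vector. So \<open>u * c\<close> enters the
  leading block and the 1 of the bottom row moves to column \<open>m - 1\<close>.\<close>

lemma Unip_Suc_mult_antidiag_block:
  fixes u :: "'a::field mat"
  assumes m: "m \<ge> 1" and u: "u \<in> Unip m" and c: "c \<in> carrier_mat m 1"
  shows "four_block_mat u (u * c) (0\<^sub>m 1 m) (1\<^sub>m 1) * antidiag_block (Suc m) a 1 =
    four_block_mat (u * companion_block m c) (a \<cdot>\<^sub>m unit_col m) (last_row m) (0\<^sub>m 1 1)"
    (is "?U * _ = ?R")
proof (rule eq_matI)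
  have uC: "u \<in> carrier_mat m m" using u by (rule Unip_carrier)
  have UC: "?U \<in> carrier_mat (Suc m) (Suc m)"
    using four_block_carrier_mat[OF uC one_carrier_mat[of 1]] by simp
  have RC: "?R \<in> carrier_mat (Suc m) (Suc m)"
    using four_block_carrier_mat[OF mult_carrier_mat[OF uC companion_block_carrier] zero_carrier_mat[of 1 1]]
    by simp
  have gC: "antidiag_block (Suc m) a 1 \<in> carrier_mat (Suc m) (Suc m)"
    by (rule antidiag_block_carrier) simp
  show "dim_row (?U * antidiag_block (Suc m) a 1) = dim_row ?R"
    "dim_col (?U * antidiag_block (Suc m) a 1) = dim_col ?R"
    using UC RC gC by auto
  fix i j assume "i < dim_row ?R" "j < dim_col ?R"
  then have ij: "i < Suc m" "j < Suc m" using RC by auto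
  have u0: "u $$ (i, 0) = (if i = 0 then 1 else 0)" if "i < m" for i
    using u m that by (auto simp: Unip_iff upper_triangular_def)
  have lhs: "(?U * antidiag_block (Suc m) a 1) $$ (i, j) =
      (if j = m then a * ?U $$ (i, 0) else ?U $$ (i, Suc j))"
    using mult_antidiag_block_index[OF UC ij] by simp
  consider "i < m" "j < m" | "i < m" "j = m" | "i = m" "j < m" | "i = m" "j = m"
    using ij by linarith
  then show "(?U * antidiag_block (Suc m) a 1) $$ (i, j) = ?R $$ (i, j)"
  proof cases
    case 1
    then have "?R $$ (i, j) = (u * companion_block m c) $$ (i, j)"
      using uC by (simp add: companion_block_def del: index_mult_mat(1))
    also have "\<dots> = (if j = m - 1 then (u * c) $$ (i, 0) else u $$ (i, Suc j))"
      by (rule mult_companion_block_index[OF uC c 1])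
    also have "\<dots> = ?U $$ (i, Suc j)"
      using 1 uC c by (auto simp del: index_mult_mat(1))
    finally show ?thesis using lhs 1 by simp
  next
    case 2
    then show ?thesis unfolding lhs
      using uC m u0[of i] by (simp add: companion_block_def unit_col_def)
  next
    case 3
    then show ?thesis unfolding lhs
      using uC m by (auto simp: companion_block_def last_row_def)
  next
    case 4
    then show ?thesis unfolding lhs
      using uC m by (simp add: companion_block_def)
  qed
qed

text \<open>Presents the last column of the bordered matrix as leading block times \<open>z\<close>,
  the form required by \<open>whittaker_vector_four_block\<close>.\<close>

lemma companion_block_solve:
  fixes c :: "'a::field mat"
  assumes m: "m \<ge> 1" and c: "c $$ (0, 0) \<noteq> 0"
  obtains z where "z \<in> carrier_mat m 1" "z $$ (m - 1, 0) = a / c $$ (0, 0)"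
    "companion_block m c * z = a \<cdot>\<^sub>m unit_col m"
proof -
  let ?x = "a / c $$ (0, 0)"
  \<comment> \<open>Row 0 of the system reads \<open>c $$ (0, 0)\<close> times the last unknown
    equals \<open>a\<close>; row \<open>Suc i\<close> then determines unknown
    \<open>i\<close>.\<close>
  define z where "z = mat m 1 (\<lambda>(i, j). if i = m - 1 then ?x else - ?x * c $$ (Suc i, 0))"
  have "companion_block m c * z = a \<cdot>\<^sub>m unit_col m"
  proof (rule eq_matI)
    fix i j assume "i < dim_row (a \<cdot>\<^sub>m unit_col m)" "j < dim_col (a \<cdot>\<^sub>m unit_col m)"
    then have ij: "i < m" "j = 0" by (auto simp: unit_col_def)
    obtain k where k: "m = Suc k" using m by (cases m) auto
    have "(companion_block m c * z) $$ (i, 0) = (\<Sum>l<Suc k. companion_block m c $$ (i, l) * z $$ (l, 0))"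
      using ij by (simp add: scalar_prod_def companion_block_def z_def k atLeast0LessThan)
    also have "\<dots> = (\<Sum>l<k. companion_block m c $$ (i, l) * z $$ (l, 0)) + c $$ (i, 0) * ?x"
      using ij by (simp add: companion_block_def z_def k)
    \<comment> \<open>For \<open>i = 0\<close> the truncated \<open>i - 1\<close> is 0 and would
      select a spurious term; the inner conditional removes it.\<close>
    also have "(\<Sum>l<k. companion_block m c $$ (i, l) * z $$ (l, 0)) =
        (\<Sum>l<k. if l = i - 1 then (if i = 0 then 0 else z $$ (l, 0)) else 0)"
      by (rule sum.cong) (use ij in \<open>auto simp: companion_block_def k\<close>)
    also have "\<dots> = (if i = 0 then 0 else - ?x * c $$ (i, 0))"
      using ij by (subst sum.delta) (auto simp: z_def k)
    finally show "(companion_block m c * z) $$ (i, j) = (a \<cdot>\<^sub>m unit_col m) $$ (i, j)"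
      using ij c by (simp add: unit_col_def)
  qed (auto simp: companion_block_def z_def unit_col_def)
  moreover have "z \<in> carrier_mat m 1" "z $$ (m - 1, 0) = ?x" using m by (simp_all add: z_def)
  ultimately show ?thesis using that by blast
qed

text \<open>The border contributes through \<open>whittaker_vector_four_block\<close> and the shear
  in the leading block through its character, which leaves the vector at the smaller antidiagonal
  matrix.\<close>

lemma whittaker_vector_antidiag_block_Suc:
  fixes u :: "'a::{field,finite} mat"
  assumes \<psi>: "additive_character \<psi>" and m: "m \<ge> 2" and u: "u \<in> Unip m"
    and c: "c \<in> carrier_mat m 1" and a: "a \<noteq> 0"
  defines "t \<equiv> c $$ (0, 0)"
  shows "whittaker_vector \<psi> \<chi> (Suc m)
      (four_block_mat u (u * c) (0\<^sub>m 1 m) (1\<^sub>m 1) * antidiag_block (Suc m) a 1) =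
    (if t = 0 then 0 else \<chi> (Suc m) (- (a / t)) * \<psi> (a / t) *
       (whittaker_vector \<psi> \<chi> m (u * antidiag_block m t 1) * \<psi> (c $$ (m - 1, 0))))"
proof -
  have m1: "m \<ge> 1" using m by simp
  have uC: "u \<in> carrier_mat m m" using u by (rule Unip_carrier)
  note gC = antidiag_block_carrier[OF m1, of t 1]
  note nC = Unip_carrier[OF shear_block_Unip[of m c]]
  let ?M = "u * companion_block m c"
  have MC: "?M \<in> carrier_mat m m" using uC by (rule mult_carrier_mat) simp
  have M: "?M = u * antidiag_block m t 1 * shear_block m c"
    unfolding antidiag_block_mult_shear_block[OF m1, symmetric] t_def[symmetric]
    using assoc_mult_mat[OF uC gC nC] by simp
  show ?thesis
  proof (cases "t = 0")
    case True
    \<comment> \<open>For \<open>t = 0\<close> the antidiagonal factor is singular, so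
      \<open>?M\<close> cannot be a product of invertible triangular matrices.\<close>
    have "det ?M = 0"
      unfolding M using True m1 uC gC nC
      by (simp add: det_mult[of _ m] det_antidiag_block mult_carrier_mat[OF uC gC])
    have "whittaker_vector \<psi> \<chi> (Suc m)
        (four_block_mat ?M (a \<cdot>\<^sub>m unit_col m) (last_row m) (0\<^sub>m 1 1)) = 0"
    proof (rule whittaker_vector_outside, rule notI)
      fix B W :: "'a mat" assume B: "B \<in> Borel_opp (Suc m)" and W: "W \<in> Unip (Suc m)"
        and eq: "four_block_mat ?M (a \<cdot>\<^sub>m unit_col m) (last_row m) (0\<^sub>m 1 1) = B * W"
      obtain b w where bw: "b \<in> Borel_opp m" "w \<in> Unip m" "?M = b * w"
        by (rule Borel_opp_Unip_top_left[OF MC smult_carrier_mat[OF unit_col_carrier]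
              last_row_carrier zero_carrier_mat B W eq])
      then have "?M \<in> GL m" using Borel_opp_subset_GL Unip_subset_GL by (auto intro!: GL_mult)
      then show False using \<open>det ?M = 0\<close> by (simp add: GL_iff_det)
    qed
    then show ?thesis using True Unip_Suc_mult_antidiag_block[OF m1 u c, of a] by simp
  next
    case False
    obtain z where z: "z \<in> carrier_mat m 1" "z $$ (m - 1, 0) = a / t"
      "companion_block m c * z = a \<cdot>\<^sub>m unit_col m"
      using companion_block_solve[OF m1, of c a] False unfolding t_def by blast
    obtain k where k: "m = Suc k" using m1 by (cases m) auto
    have "u * unit_col m = unit_col m"
    proof (rule eq_matI)
      fix i j assume "i < dim_row (unit_col m :: 'a mat)" "j < dim_col (unit_col m :: 'a mat)"
      then show "(u * unit_col m) $$ (i, j) = unit_col m $$ (i, j)"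
        using u mult_unit_col_entry[of u m k i] uC
        by (auto simp: unit_col_def Unip_iff upper_triangular_def k)
    qed (use uC in \<open>auto simp: unit_col_def\<close>)
    \<comment> \<open>As \<open>u\<close> fixes the first basis vector, the solution
      \<open>z\<close> for the companion matrix also works for \<open>?M\<close>.\<close>
    then have "?M * z = a \<cdot>\<^sub>m unit_col m"
      using assoc_mult_mat[OF uC companion_block_carrier z(1)] z(3)
        mult_smult_distrib[OF uC unit_col_carrier] by simp
    moreover have "a / t \<noteq> 0" using a False by simp
    ultimately have "whittaker_vector \<psi> \<chi> (Suc m)
        (four_block_mat ?M (a \<cdot>\<^sub>m unit_col m) (last_row m) (0\<^sub>m 1 1)) =
      \<chi> (Suc m) (- (a / t)) * \<psi> (a / t) * whittaker_vector \<psi> \<chi> m ?M"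
      using whittaker_vector_four_block[OF \<psi> m1 MC z(1,2), of \<chi>] by simp
    moreover have "whittaker_vector \<psi> \<chi> m ?M =
        whittaker_vector \<psi> \<chi> m (u * antidiag_block m t 1) * \<psi> (c $$ (m - 1, 0))"
      unfolding M whittaker_vector_mult_Unip[OF \<psi> shear_block_Unip mult_carrier_mat[OF uC gC]]
        unip_character_shear_block[OF m] ..
    ultimately show ?thesis using False Unip_Suc_mult_antidiag_block[OF m1 u c, of a] by simp
  qed
qed

section \<open>Summation over the last column\<close>

lemma sum_carrier_mat_col:
  fixes f :: "'a::finite \<Rightarrow> complex"
  shows "(\<Sum>c\<in>carrier_mat (Suc k) 1. f (c $$ (0, 0))) = of_nat CARD('a) ^ k * (\<Sum>t\<in>UNIV. f t)"
proof -
  have "(\<Sum>c\<in>carrier_mat (Suc k) 1. f (c $$ (0, 0))) =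
      (\<Sum>(t, c)\<in>UNIV \<times> (carrier_mat k 1 :: 'a mat set). f t)"
  proof (rule sum.reindex_bij_witness[where i =
        "\<lambda>(t, c). mat (Suc k) 1 (\<lambda>(i, j). if i = 0 then t else c $$ (i - 1, j))"
        and j = "\<lambda>c. (c $$ (0, 0), mat k 1 (\<lambda>(i, j). c $$ (Suc i, j)))"])
    fix c :: "'a mat" assume c: "c \<in> carrier_mat (Suc k) 1"
    show "(case (c $$ (0, 0), mat k 1 (\<lambda>(i, j). c $$ (Suc i, j))) of
        (t, c) \<Rightarrow> mat (Suc k) 1 (\<lambda>(i, j). if i = 0 then t else c $$ (i - 1, j))) = c"
      by (rule eq_matI) (use c in auto)
  next
    fix x :: "'a \<times> 'a mat" assume "x \<in> UNIV \<times> carrier_mat k 1"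
    then obtain t c where x: "x = (t, c)" and c: "c \<in> carrier_mat k 1" by auto
    have "mat k 1 (\<lambda>(i, j). mat (Suc k) 1 (\<lambda>(i, j). if i = 0 then t else c $$ (i - 1, j)) $$ (Suc i, j)) = c"
      by (rule eq_matI) (use c in auto)
    then show "((case x of (t, c) \<Rightarrow> mat (Suc k) 1 (\<lambda>(i, j). if i = 0 then t else c $$ (i - 1, j))) $$ (0, 0),
        mat k 1 (\<lambda>(i, j). (case x of (t, c) \<Rightarrow> mat (Suc k) 1 (\<lambda>(i, j). if i = 0 then t else c $$ (i - 1, j))) $$ (Suc i, j))) = x"
      by (simp add: x)
  qed auto
  \<comment> \<open>Fixing the top entry leaves \<open>k\<close> free entries, on which the summand
    does not depend.\<close>
  also have "\<dots> = of_nat CARD('a) ^ k * (\<Sum>t\<in>UNIV. f t)"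
    by (simp add: sum.cartesian_product[symmetric] card_carrier_mat sum_distrib_left)
  finally show ?thesis .
qed

text \<open>Once the shear contribution has cancelled, the summand sees only the first entry of
  \<open>c\<close>; the other \<open>m - 1\<close> entries produce the power of q.\<close>

lemma whittaker_sum_antidiag_block_Suc:
  fixes \<psi> :: "'a::{field,finite} \<Rightarrow> complex"
  assumes \<psi>: "additive_character \<psi>" and m: "m \<ge> 2" and a: "a \<noteq> 0"
  shows "whittaker_sum \<psi> \<chi> (Suc m) (antidiag_block (Suc m) a 1) =
    of_nat CARD('a) ^ (m - 1) * (\<Sum>t\<in>UNIV - {0}. \<chi> (Suc m) (- (a / t)) * \<psi> (a / t) *
      whittaker_sum \<psi> \<chi> m (antidiag_block m t 1))"
proof -
  let ?e = "\<lambda>u c. four_block_mat u (u * c) (0\<^sub>m 1 m) (1\<^sub>m 1) :: 'a mat"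
  \<comment> \<open>The value 0 at \<open>t = 0\<close> encodes the vanishing for a singular leading
    block and permits summing over the whole field.\<close>
  let ?G = "\<lambda>t. if t = 0 then 0 else \<chi> (Suc m) (- (a / t)) * \<psi> (a / t)"
  let ?w = "\<lambda>u t. whittaker_vector \<psi> \<chi> m (u * antidiag_block m t 1) * cnj (unip_character \<psi> m u)"
  have m1: "m \<ge> 1" using m by simp
  have "whittaker_sum \<psi> \<chi> (Suc m) (antidiag_block (Suc m) a 1) =
      (\<Sum>(u, c)\<in>Unip m \<times> carrier_mat m 1.
        whittaker_vector \<psi> \<chi> (Suc m) (?e u c * antidiag_block (Suc m) a 1) *
        cnj (unip_character \<psi> (Suc m) (?e u c)))"
    unfolding whittaker_sum_def sum.reindex_bij_betw[OF Unip_Suc, symmetric]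
    by (simp only: case_prod_unfold)
  \<comment> \<open>The last entries of \<open>u * c\<close> and \<open>c\<close> agree, so the
    conjugated character of the bordered matrix contains the inverse of the shear factor
    \<open>\<psi> (c $$ (m - 1, 0))\<close>.\<close>
  also have "\<dots> = (\<Sum>(u, c)\<in>Unip m \<times> carrier_mat m 1. ?G (c $$ (0, 0)) * ?w u (c $$ (0, 0)))"
  proof (rule sum.cong[OF refl], clarify)
    fix u c :: "'a mat" assume u: "u \<in> Unip m" and c: "c \<in> carrier_mat m 1"
    have uC: "u \<in> carrier_mat m m" using u by (rule Unip_carrier)
    have uc: "u * c \<in> carrier_mat m 1" using mult_carrier_mat[OF uC c] .
    have "(u * c) $$ (m - 1, 0) = c $$ (m - 1, 0)"
      using last_row_mult_entry[OF m1 uc, of 0] last_row_mult_entry[OF m1 c, of 0]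
        assoc_mult_mat[OF last_row_carrier uC c] last_row_mult_Unip[OF m1 u] by simp
    then have ch: "unip_character \<psi> (Suc m) (?e u c) = unip_character \<psi> m u * \<psi> (c $$ (m - 1, 0))"
      using unip_character_four_block[OF \<psi> m1 uC uc] by simp
    show "whittaker_vector \<psi> \<chi> (Suc m) (?e u c * antidiag_block (Suc m) a 1) *
        cnj (unip_character \<psi> (Suc m) (?e u c)) = ?G (c $$ (0, 0)) * ?w u (c $$ (0, 0))"
      unfolding whittaker_vector_antidiag_block_Suc[OF \<psi> m u c a] ch
      using additive_character_unimodular[OF \<psi>, of "c $$ (m - 1, 0)"]
      by (simp add: mult_ac)
  qed
  also have "\<dots> = (\<Sum>c\<in>carrier_mat m 1. ?G (c $$ (0, 0)) *
      whittaker_sum \<psi> \<chi> m (antidiag_block m (c $$ (0, 0)) 1))"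
    unfolding sum.cartesian_product[symmetric]
    by (subst sum.swap) (simp only: whittaker_sum_def sum_distrib_left)
  also have "\<dots> = of_nat CARD('a) ^ (m - 1) *
      (\<Sum>t\<in>UNIV. ?G t * whittaker_sum \<psi> \<chi> m (antidiag_block m t 1))"
    using sum_carrier_mat_col[of "\<lambda>t. ?G t * whittaker_sum \<psi> \<chi> m (antidiag_block m t 1)" "m - 1"] m1
    by simp
  also have "(\<Sum>t\<in>UNIV. ?G t * whittaker_sum \<psi> \<chi> m (antidiag_block m t 1)) =
      (\<Sum>t\<in>UNIV - {0}. \<chi> (Suc m) (- (a / t)) * \<psi> (a / t) *
        whittaker_sum \<psi> \<chi> m (antidiag_block m t 1))"
    by (rule sum.mono_neutral_cong_right) auto
  finally show ?thesis .
qed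

theorem theorem3p2:
  fixes \<psi> :: "'a::{field,finite} \<Rightarrow> complex"
    and \<chi> :: "nat \<Rightarrow> 'a \<Rightarrow> complex"
    and p k n :: nat
    and a1 :: 'a
  assumes "prime p" and "odd p" and "CARD('a) = p ^ k"
    and "nontrivial_additive_character \<psi>"
    and "n \<ge> 3"
    and "\<And>i. i \<in> {1..n} \<Longrightarrow> multiplicative_character (\<chi> i)"
    and "a1 \<noteq> 0"
  shows "whittaker_function \<psi> \<chi> n (antidiag_block n a1 1) =
    of_nat CARD('a) ^ (n - 2) * (of_nat CARD('a) - 1) / (of_nat CARD('a) ^ n - 1) *
    (\<Sum>t1\<in>UNIV - {0}. \<chi> n (- (a1 / t1)) * \<psi> (a1 / t1) *
       whittaker_function \<psi> \<chi> (n - 1) (antidiag_block (n - 1) t1 1))"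
proof -
  obtain m where n: "n = Suc m" and m: "m \<ge> 2" using assms(5) by (cases n) auto
  have \<psi>: "additive_character \<psi>" using assms(4) by (simp add: nontrivial_additive_character_def)
  \<comment> \<open>The reciprocal of the index of the Borel subgroup, so \<open>ratio\<close> links
    Whittaker functions to Whittaker sums in both ranks.\<close>
  define ratio :: "nat \<Rightarrow> complex" where
    "ratio m = of_nat (card (Borel_opp m :: 'a mat set)) / of_nat (card (GL m :: 'a mat set))" for m
  have ratio: "ratio (Suc m) = (of_nat CARD('a) - 1) / (of_nat CARD('a) ^ Suc m - 1) * ratio m"
    unfolding ratio_def by (rule card_index_ratio_Suc)
  have W: "whittaker_function \<psi> \<chi> l (antidiag_block l t 1) =
      ratio l * whittaker_sum \<psi> \<chi> l (antidiag_block l t 1)"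
    if "l \<in> {1..n}" "t \<noteq> 0" for l t
    unfolding ratio_def
    by (rule whittaker_function_eq_sum) (use assms(6) that in \<open>auto simp: antidiag_block_GL\<close>)
  have "(\<Sum>t\<in>UNIV - {0}. \<chi> n (- (a1 / t)) * \<psi> (a1 / t) *
        whittaker_function \<psi> \<chi> m (antidiag_block m t 1)) =
      ratio m * (\<Sum>t\<in>UNIV - {0}. \<chi> n (- (a1 / t)) * \<psi> (a1 / t) *
        whittaker_sum \<psi> \<chi> m (antidiag_block m t 1))"
    unfolding sum_distrib_left by (rule sum.cong) (use W m n in auto)
  \<comment> \<open>With \<open>m - 1 = n - 2\<close>, the power of q comes from the recursion for
    the sums and the rest of the constant from replacing \<open>ratio (Suc m)\<close> by a multiple
    of \<open>ratio m\<close>.\<close>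
  then show ?thesis
    using W[of n a1] assms(7) whittaker_sum_antidiag_block_Suc[OF \<psi> m assms(7), of \<chi>] ratio m
    by (simp add: n del: power_Suc)
qed

end
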